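(* Let $p_{\rm c}:=\frac{N}{N-2\beta}$, $p\in[1,p_{\rm c})$, $q\in[1,p)$, and $u_0\in L^p(\mathbb{R}^N)\cap L^q(\mathbb{R}^N)$. If $u$ is an $L^p$-solution of $\partial_t^\alpha u+(-\Delta)^\beta u=|u|^{p-1}u$ with initial datum $u_0$ and existence time $T$, then $u$ is also an $L^q$-solution (with initial datum $u_0$ and existence time $T$). Moreover, $u\in C([0,T);L^q(\mathbb{R}^N))$.
   Context: Throughout, $N\ge1$ is an integer, $\alpha\in(0,1)$, $\beta\in(0,1]$, and $N>4\beta$. $\partial_t^\alpha$ is the Caputo derivative, $\partial_t^\alpha u(x,t)=\frac1{\Gamma(1-\alpha)}\partial_t\int_0^t\frac{u(x,s)-u(x,0)}{(t-s)^\alpha}ds$, and $(-\Delta)^\beta$ is the operator with Fourier symbol $|\xi|^{2\beta}$. $Z$ is the fundamental solution of $\partial_t^\alpha u+(-\Delta)^\beta u=0$ (initial datum a Dirac mass at $0$), and $Y(x,t)={}^{R}\partial_t^{1-\alpha}Z(x,t)=\frac{1}{\Gamma(\alpha)}\partial_t\int_0^t\frac{Z(x,s)}{(t-s)^{1-\alpha}}ds$. Equivalently, in terms of spatial Fourier transforms, $\hat Z(\xi,t)=E_{\alpha,1}(-|\xi|^{2\beta}t^\alpha)$ and $\hat Y(\xi,t)=t^{\alpha-1}E_{\alpha,\alpha}(-|\xi|^{2\beta}t^\alpha)$, with $E_{\alpha,\gamma}$ the Mittag-Leffler functions. For $m\in[1,\infty]$ and $u_0\in L^m(\mathbb{R}^N)$,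 an $L^m$-solution of $\partial_t^\alpha u+(-\Delta)^\beta u=|u|^{p-1}u$ with initial datum $u_0$ and existence time $T\in(0,\infty]$ is a function $u\in L^\infty_{\rm loc}([0,T);L^m(\mathbb{R}^N))$ such that, for almost all $t\in(0,T)$, $$u(x,t)=\int_{\mathbb{R}^N} u_0(y)Z(x-y,t)\,dy+\int_0^t\int_{\mathbb{R}^N}|u(y,s)|^{p-1}u(y,s)Y(x-y,t-s)\,dy\,ds$$ as an identity in $L^m(\mathbb{R}^N)$, and $\operatorname{ess\,lim}_{t\to0^+}\|u(\cdot,t)-u_0\|_{L^m(\mathbb{R}^N)}=0$. Membership in $C([0,T);L^q(\mathbb{R}^N))$ is understood for the representative given by the right-hand side of this formula for all $t\in(0,T)$, with value $u_0$ at $t=0$. *)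

theory Defs
  imports "HOL-Analysis.Analysis"
begin

section \<open>Lebesgue spaces\<close>

text \<open>
  Elements of \<open>L\<^sup>m(\<real>\<^sup>N)\<close> are given by Borel representatives; only finite exponents are needed.
  The value of \<open>Lm_norm m f\<close> is meaningful only if \<open>in_Lm m f\<close> holds.
\<close>

definition in_Lm :: "real \<Rightarrow> ('a::euclidean_space \<Rightarrow> real) \<Rightarrow> bool" where
  "in_Lm m f \<longleftrightarrow> f \<in> borel_measurable lborel \<and> integrable lborel (\<lambda>x. \<bar>f x\<bar> powr m)"

definition Lm_norm :: "real \<Rightarrow> ('a::euclidean_space \<Rightarrow> real) \<Rightarrow> real" where
  "Lm_norm m f = (LINT x|lborel. \<bar>f x\<bar> powr m) powr (1 / m)"


section \<open>The kernels\<close>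

definition mittag_leffler :: "real \<Rightarrow> real \<Rightarrow> real \<Rightarrow> real" where
  "mittag_leffler a c z = (\<Sum>k. z ^ k / Gamma (a * real k + c))"

definition fourier :: "('a::euclidean_space \<Rightarrow> real) \<Rightarrow> 'a \<Rightarrow> complex" where
  "fourier f \<xi> = (LINT x|lborel. exp (- \<i> * complex_of_real (x \<bullet> \<xi>)) * complex_of_real (f x))"

text \<open>
  The fundamental solution \<open>Z\<close> of \<open>\<partial>\<^sub>t\<^sup>\<alpha> u + (-\<Delta>)\<^sup>\<beta> u = 0\<close> is described by its spatial Fourier transform:
  \<open>t \<mapsto> E\<^sub>\<alpha>\<^sub>,\<^sub>1(-\<bar>\<xi>\<bar>\<^sup>2\<^sup>\<beta> t\<^sup>\<alpha>)\<close> solves the transformed Caputo equation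
  \<open>\<partial>\<^sub>t\<^sup>\<alpha> w + \<bar>\<xi>\<bar>\<^sup>2\<^sup>\<beta> w = 0\<close> with \<open>w(0) = 1\<close>, the transform of the Dirac mass.
  Applying the Riemann--Liouville derivative of order \<open>1 - \<alpha>\<close> in \<open>t\<close> to it gives the transform
  of \<open>Y\<close>.  Since the slices are in \<open>L\<^sup>1\<close>, the transforms determine \<open>Z(\<cdot>,t)\<close> and \<open>Y(\<cdot>,t)\<close>
  almost everywhere, for every \<open>t > 0\<close>; values at \<open>t \<le> 0\<close> are irrelevant.
  (The transforms are in general not integrable, so pointwise Fourier inversion is not available.)
\<close>

definition is_kernel_Z ::
  "real \<Rightarrow> real \<Rightarrow> ('a::euclidean_space \<Rightarrow> real \<Rightarrow> real) \<Rightarrow> bool" where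
  "is_kernel_Z \<alpha> \<beta> Z \<longleftrightarrow>
     (\<lambda>(x, t). Z x t) \<in> borel_measurable (restrict_space borel (UNIV \<times> {0<..})) \<and>
     (\<forall>t>0. integrable lborel (\<lambda>x. Z x t) \<and>
        (\<forall>\<xi>. fourier (\<lambda>x. Z x t) \<xi> =
           complex_of_real (mittag_leffler \<alpha> 1 (- (norm \<xi> powr (2 * \<beta>) * t powr \<alpha>)))))"

definition is_kernel_Y ::
  "real \<Rightarrow> real \<Rightarrow> ('a::euclidean_space \<Rightarrow> real \<Rightarrow> real) \<Rightarrow> bool" where
  "is_kernel_Y \<alpha> \<beta> Y \<longleftrightarrow>
     (\<lambda>(x, t). Y x t) \<in> borel_measurable (restrict_space borel (UNIV \<times> {0<..})) \<and>
     (\<forall>t>0. integrable lborel (\<lambda>x. Y x t) \<and>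
        (\<forall>\<xi>. fourier (\<lambda>x. Y x t) \<xi> =
           complex_of_real (t powr (\<alpha> - 1) *
             mittag_leffler \<alpha> \<alpha> (- (norm \<xi> powr (2 * \<beta>) * t powr \<alpha>)))))"


section \<open>Solutions of \<open>\<partial>\<^sub>t\<^sup>\<alpha> u + (-\<Delta>)\<^sup>\<beta> u = \<bar>u\<bar>\<^sup>p\<^sup>-\<^sup>1 u\<close>\<close>

definition duhamel_rhs ::
  "('a::euclidean_space \<Rightarrow> real \<Rightarrow> real) \<Rightarrow> ('a \<Rightarrow> real \<Rightarrow> real) \<Rightarrow> real \<Rightarrow>
   ('a \<Rightarrow> real) \<Rightarrow> ('a \<Rightarrow> real \<Rightarrow> real) \<Rightarrow> real \<Rightarrow> 'a \<Rightarrow> real" where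
  "duhamel_rhs Z Y p u0 u t x =
     (LINT y|lborel. u0 y * Z (x - y) t) +
     (LINT s:{0<..<t}|lborel. (LINT y|lborel. \<bar>u y s\<bar> powr (p - 1) * u y s * Y (x - y) (t - s)))"

text \<open>
  The integrals in \<open>duhamel_rhs\<close> converge absolutely for almost every \<open>x\<close>; this has to be said
  because a divergent integral has the value 0 in HOL.
\<close>

definition duhamel_converges ::
  "('a::euclidean_space \<Rightarrow> real \<Rightarrow> real) \<Rightarrow> ('a \<Rightarrow> real \<Rightarrow> real) \<Rightarrow> real \<Rightarrow>
   ('a \<Rightarrow> real) \<Rightarrow> ('a \<Rightarrow> real \<Rightarrow> real) \<Rightarrow> real \<Rightarrow> bool" where
  "duhamel_converges Z Y p u0 u t \<longleftrightarrow>
     (AE x in lborel. integrable lborel (\<lambda>y. u0 y * Z (x - y) t) \<and>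
        set_integrable lborel (UNIV \<times> {0<..<t})
          (\<lambda>(y, s). \<bar>u y s\<bar> powr (p - 1) * u y s * Y (x - y) (t - s)))"

text \<open>
  \<open>L\<^sup>\<infinity>\<^sub>l\<^sub>o\<^sub>c([0,T); L\<^sup>m)\<close>: a (strongly measurable) function of time with values in \<open>L\<^sup>m\<close> is given by
  a jointly measurable representative, and it is essentially bounded on \<open>(0,\<tau>)\<close> for each
  \<open>\<tau> < T\<close>, so up to the initial time.
\<close>

definition Linf_loc_Lm :: "real \<Rightarrow> ereal \<Rightarrow> ('a::euclidean_space \<Rightarrow> real \<Rightarrow> real) \<Rightarrow> bool" where
  "Linf_loc_Lm m T u \<longleftrightarrow>
     (\<lambda>(x, t). u x t) \<in>
        borel_measurable (restrict_space borel (UNIV \<times> {t. 0 < t \<and> ereal t < T})) \<and>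
     (\<forall>\<tau>. 0 < \<tau> \<and> ereal \<tau> < T \<longrightarrow>
        (\<exists>M. AE t in lborel. 0 < t \<and> t < \<tau> \<longrightarrow>
           in_Lm m (\<lambda>x. u x t) \<and> Lm_norm m (\<lambda>x. u x t) \<le> M))"

definition Lm_solution ::
  "('a::euclidean_space \<Rightarrow> real \<Rightarrow> real) \<Rightarrow> ('a \<Rightarrow> real \<Rightarrow> real) \<Rightarrow> real \<Rightarrow> real \<Rightarrow>
   ('a \<Rightarrow> real) \<Rightarrow> ereal \<Rightarrow> ('a \<Rightarrow> real \<Rightarrow> real) \<Rightarrow> bool" where
  "Lm_solution Z Y p m u0 T u \<longleftrightarrow>
     1 \<le> m \<and> in_Lm m u0 \<and> 0 < T \<and> Linf_loc_Lm m T u \<and>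
     (AE t in lborel. 0 < t \<and> ereal t < T \<longrightarrow>
        duhamel_converges Z Y p u0 u t \<and>
        in_Lm m (\<lambda>x. u x t) \<and> in_Lm m (duhamel_rhs Z Y p u0 u t) \<and>
        (AE x in lborel. u x t = duhamel_rhs Z Y p u0 u t x)) \<and>
     (\<forall>\<epsilon>>0. \<exists>\<delta>>0. AE t in lborel. 0 < t \<and> t < \<delta> \<and> ereal t < T \<longrightarrow>
        in_Lm m (\<lambda>x. u x t - u0 x) \<and> Lm_norm m (\<lambda>x. u x t - u0 x) < \<epsilon>)"

definition duhamel_representative ::
  "('a::euclidean_space \<Rightarrow> real \<Rightarrow> real) \<Rightarrow> ('a \<Rightarrow> real \<Rightarrow> real) \<Rightarrow> real \<Rightarrow>
   ('a \<Rightarrow> real) \<Rightarrow> ('a \<Rightarrow> real \<Rightarrow> real) \<Rightarrow> 'a \<Rightarrow> real \<Rightarrow> real" where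
  "duhamel_representative Z Y p u0 u x t = (if t = 0 then u0 x else duhamel_rhs Z Y p u0 u t x)"

definition continuous_Lm :: "real \<Rightarrow> ereal \<Rightarrow> ('a::euclidean_space \<Rightarrow> real \<Rightarrow> real) \<Rightarrow> bool" where
  "continuous_Lm m T v \<longleftrightarrow>
     (\<forall>t. 0 \<le> t \<and> ereal t < T \<longrightarrow> in_Lm m (\<lambda>x. v x t)) \<and>
     (\<forall>t0. 0 \<le> t0 \<and> ereal t0 < T \<longrightarrow>
        ((\<lambda>t. Lm_norm m (\<lambda>x. v x t - v x t0)) \<longlongrightarrow> 0) (at t0 within {t. 0 \<le> t \<and> ereal t < T}))"

end

theory Submission
  imports Defs "HOL-Probability.Characteristic_Functions"
begin

text \<open>
  The representative of \<open>u\<close> is a sum \<open>A(t) + D(t)\<close> of a linear part, which depends on \<open>u\<^sub>0\<close> only, and the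
  Duhamel integral of the source \<open>\<bar>u\<bar>\<^sup>p\<^sup>-\<^sup>1 u\<close>. These are treated separately.

  Self-similarity. The transforms of \<open>Z(\<cdot>,t)\<close> and \<open>Y(\<cdot>,t)\<close> arise from those at time 1 by the dilation
  \<open>\<xi> \<mapsto> l(t) \<xi>\<close>, \<open>l(t) = t\<^bsup>\<alpha>/(2\<beta>)\<^esup>\<close>, and the factors 1 and \<open>t\<^sup>\<alpha>\<^sup>-\<^sup>1\<close>. As the Fourier transform is injective on
  \<open>L\<^sup>1\<close> (\<open>fourier_inject_AE\<close>), a convolution with one of the kernels at time \<open>t\<close> is, up to this factor, an average
  \<open>\<integral> f(x - l(t) z) K(z) dz\<close> of translates of \<open>f\<close>, with a fixed \<open>K\<close> in \<open>L\<^sup>1\<close> (\<open>dilated_kernel_convolution\<close>).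

  Linear part. Translations are continuous in \<open>L\<^sup>q\<close>, hence so are such averages as functions of \<open>l(t)\<close>
  (\<open>dilation_average_tendsto\<close>). Thus \<open>A\<close> is continuous into \<open>L\<^sup>q\<close> on \<open>[0,T)\<close>, and \<open>A(0) = u\<^sub>0\<close> because \<open>Z(\<cdot>,1)\<close> has integral 1.

  Duhamel part. A bound for \<open>u\<close> in \<open>L\<^sup>p\<close> is a bound for the source in \<open>L\<^sup>1\<close>. Since \<open>s \<mapsto> s\<^sup>\<alpha>\<^sup>-\<^sup>1\<close> is integrable at 0,
  \<open>D\<close> is locally bounded and continuous with values in \<open>L\<^sup>1\<close> (\<open>duhamel_average_tendsto\<close>), and \<open>D(0) = 0\<close>. On the other
  hand \<open>D = u - A\<close> is bounded in \<open>L\<^sup>p\<close> at almost every time, and then at every time by Fatou's lemma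
  (\<open>nonlinear_part_Lp_bound\<close>). Interpolating between \<open>L\<^sup>1\<close> and \<open>L\<^sup>p\<close> gives continuity of \<open>D\<close> into \<open>L\<^sup>q\<close> for
  \<open>1 \<le> q < p\<close>.

  So the representative is continuous into \<open>L\<^sup>q\<close> with value \<open>u\<^sub>0\<close> at time 0. It agrees with \<open>u\<close> at almost every
  time, which makes \<open>u\<close> an \<open>L\<^sup>q\<close>-solution.
\<close>

section \<open>Inequalities for real powers\<close>

lemma powr_superadditive:
  fixes a b q :: real
  assumes "0 \<le> a" "0 \<le> b" "1 \<le> q"
  shows "a powr q + b powr q \<le> (a + b) powr q"
proof -
  have split: "x powr q = x * x powr (q - 1)" if "0 \<le> x" for x :: real
    using that assms(3) by (cases "x = 0") (auto simp: powr_mult_base)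
  have "a powr q + b powr q = a * a powr (q - 1) + b * b powr (q - 1)"
    using assms by (simp add: split)
  also have "\<dots> \<le> a * (a + b) powr (q - 1) + b * (a + b) powr (q - 1)"
    using assms by (intro add_mono mult_left_mono powr_mono2) auto
  also have "\<dots> = (a + b) powr q"
    using assms by (simp add: split distrib_right)
  finally show ?thesis .
qed

lemma powr_add_le:
  fixes a b q :: real
  assumes "0 \<le> a" "0 \<le> b" "0 \<le> q"
  shows "(a + b) powr q \<le> 2 powr q * (a powr q + b powr q)"
proof -
  have "(a + b) powr q \<le> (2 * max a b) powr q"
    using assms by (intro powr_mono2) auto
  also have "\<dots> = 2 powr q * max a b powr q"
    using assms by (simp add: powr_mult)
  also have "\<dots> \<le> 2 powr q * (a powr q + b powr q)"
    by (intro mult_left_mono) (auto simp: max_def)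
  finally show ?thesis .
qed

text \<open>
  The map \<open>f \<mapsto> sgn f \<bar>f\<bar>\<^sup>q\<close> carries \<open>L\<^sup>q\<close> into \<open>L\<^sup>1\<close> and commutes with translations. It is used to deduce
  continuity of translations in \<open>L\<^sup>q\<close> from the case \<open>q = 1\<close>.
\<close>

definition signed_powr :: "real \<Rightarrow> real \<Rightarrow> real" where
  "signed_powr q a = sgn a * \<bar>a\<bar> powr q"

lemma abs_signed_powr [simp]: "\<bar>signed_powr q a\<bar> = \<bar>a\<bar> powr q"
  by (simp add: signed_powr_def abs_mult abs_sgn_eq)

lemma signed_powr_measurable [measurable]: "signed_powr q \<in> borel_measurable borel"
  unfolding signed_powr_def by measurable

text \<open>
  The inverse of the signed power is Hoelder continuous of order \<open>1/q\<close>. For arguments of the same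
  sign this is superadditivity of \<open>t \<mapsto> t\<^sup>q\<close>; for opposite signs both sides compare sums.
\<close>

lemma abs_diff_powr_le_signed_powr:
  fixes a b q :: real
  assumes q: "1 \<le> q"
  shows "\<bar>a - b\<bar> powr q \<le> 2 powr q * \<bar>signed_powr q a - signed_powr q b\<bar>"
proof -
  have one: "1 \<le> 2 powr q" using q by (simp add: ge_one_powr_ge_zero)
  have same: "(x - y) powr q \<le> x powr q - y powr q" if "0 \<le> y" "y \<le> x" for x y :: real
    using powr_superadditive[of "x - y" y q] that q by simp
  have same': "\<bar>x - y\<bar> powr q \<le> 2 powr q * \<bar>x powr q - y powr q\<bar>"
    if "0 \<le> y" "0 \<le> x" for x y :: real
  proof -
    have "\<bar>x - y\<bar> powr q \<le> \<bar>x powr q - y powr q\<bar>"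
      using same[of y x] same[of x y] that by (cases "x \<le> y") (auto simp: abs_if)
    also have "\<dots> \<le> 2 powr q * \<bar>x powr q - y powr q\<bar>"
      using mult_right_mono[OF one, of "\<bar>x powr q - y powr q\<bar>"] by simp
    finally show ?thesis .
  qed
  have opp: "\<bar>x + y\<bar> powr q \<le> 2 powr q * \<bar>x powr q + y powr q\<bar>"
    if "0 \<le> y" "0 \<le> x" for x y :: real
    using powr_add_le[of x y q] that q by simp
  consider "0 \<le> a" "0 \<le> b" | "a < 0" "b < 0" | "a < 0" "0 \<le> b" | "0 \<le> a" "b < 0" by linarith
  then show ?thesis
  proof cases
    case 1
    then show ?thesis using same'[of b a] by (auto simp: signed_powr_def sgn_if)
  next
    case 2
    then show ?thesis using same'[of "-a" "-b"] by (auto simp: signed_powr_def sgn_if abs_minus_commute)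
  next
    case 3
    have "\<bar>a - b\<bar> = \<bar>- a + b\<bar>"
      "\<bar>signed_powr q a - signed_powr q b\<bar> = \<bar>(- a) powr q + b powr q\<bar>"
      using 3 powr_ge_zero[of "-a" q] powr_ge_zero[of b q]
      by (auto simp: signed_powr_def sgn_if simp del: powr_ge_zero)
    then show ?thesis using 3 opp[of b "-a"] by simp
  next
    case 4
    then show ?thesis using opp[of "-b" a] by (auto simp: signed_powr_def sgn_if)
  qed
qed

lemma powr_add_abs_le:
  fixes a b q :: real
  assumes "0 \<le> q"
  shows "\<bar>a + b\<bar> powr q \<le> 2 powr q * (\<bar>a\<bar> powr q + \<bar>b\<bar> powr q)"
proof -
  have "\<bar>a + b\<bar> powr q \<le> (\<bar>a\<bar> + \<bar>b\<bar>) powr q"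
    using assms by (intro powr_mono2) auto
  also have "\<dots> \<le> 2 powr q * (\<bar>a\<bar> powr q + \<bar>b\<bar> powr q)"
    using assms by (intro powr_add_le) auto
  finally show ?thesis .
qed

section \<open>Continuity of translations in \<open>L\<^sup>1\<close>\<close>

lemma nn_integral_lborel_translate:
  fixes h :: "'a::euclidean_space" and f :: "'a \<Rightarrow> ennreal"
  assumes [measurable]: "f \<in> borel_measurable borel"
  shows "(\<integral>\<^sup>+x. f (x - h) \<partial>lborel) = (\<integral>\<^sup>+x. f x \<partial>lborel)"
proof -
  have "(\<integral>\<^sup>+x. f x \<partial>lborel) = (\<integral>\<^sup>+x. f x \<partial>distr lborel borel ((+) (- h)))"
    by (simp add: lborel_distr_plus)
  also have "\<dots> = (\<integral>\<^sup>+x. f (- h + x) \<partial>lborel)"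
    by (subst nn_integral_distr) auto
  finally show ?thesis by simp
qed

lemma integrable_lborel_translate:
  fixes h :: "'a::euclidean_space" and f :: "'a \<Rightarrow> real"
  assumes "integrable lborel f"
  shows "integrable lborel (\<lambda>x. f (x - h))"
proof -
  have [measurable]: "f \<in> borel_measurable borel" using assms by auto
  show ?thesis
    using assms nn_integral_lborel_translate[of "\<lambda>x. ennreal (norm (f x))" h]
    by (auto simp: integrable_iff_bounded)
qed

lemma lborel_integral_translate:
  fixes h :: "'a::euclidean_space" and f :: "'a \<Rightarrow> real"
  assumes [measurable]: "f \<in> borel_measurable borel"
  shows "(LINT x|lborel. f (x - h)) = (LINT x|lborel. f x)"
proof -
  have "(LINT x|lborel. f x) = (LINT x|distr lborel borel ((+) (- h)). f x)"
    by (simp add: lborel_distr_plus)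
  also have "\<dots> = (LINT x|lborel. f (- h + x))"
    by (subst integral_distr) auto
  finally show ?thesis by simp
qed

text \<open>
  An integral in \<open>ennreal\<close> is measurable in the shift and can itself be integrated over shifts
  without a separate integrability condition.
\<close>

definition translation_modulus :: "('a::euclidean_space \<Rightarrow> real) \<Rightarrow> 'a \<Rightarrow> ennreal" where
  "translation_modulus f h = (\<integral>\<^sup>+x. ennreal \<bar>f (x - h) - f x\<bar> \<partial>lborel)"

lemma translation_modulus_le_add:
  fixes f g :: "'a::euclidean_space \<Rightarrow> real"
  assumes [measurable]: "f \<in> borel_measurable borel" "g \<in> borel_measurable borel"
  shows "translation_modulus f h \<le> translation_modulus g h + 2 * (\<integral>\<^sup>+x. ennreal \<bar>f x - g x\<bar> \<partial>lborel)"
proof -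
  have "translation_modulus f h \<le> (\<integral>\<^sup>+x. ennreal \<bar>g (x - h) - g x\<bar>
     + (ennreal \<bar>f (x - h) - g (x - h)\<bar> + ennreal \<bar>f x - g x\<bar>) \<partial>lborel)"
    unfolding translation_modulus_def
    by (intro nn_integral_mono) (auto simp flip: ennreal_plus intro!: ennreal_leI)
  also have "\<dots> = translation_modulus g h + ((\<integral>\<^sup>+x. ennreal \<bar>f (x - h) - g (x - h)\<bar> \<partial>lborel)
       + (\<integral>\<^sup>+x. ennreal \<bar>f x - g x\<bar> \<partial>lborel))"
    by (simp add: nn_integral_add translation_modulus_def)
  also have "(\<integral>\<^sup>+x. ennreal \<bar>f (x - h) - g (x - h)\<bar> \<partial>lborel) = (\<integral>\<^sup>+x. ennreal \<bar>f x - g x\<bar> \<partial>lborel)"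
    by (subst nn_integral_lborel_translate[of "\<lambda>x. ennreal \<bar>f x - g x\<bar>"]) auto
  finally show ?thesis by (simp add: mult_2)
qed

lemma translation_modulus_le_norm:
  fixes f :: "'a::euclidean_space \<Rightarrow> real"
  assumes [measurable]: "f \<in> borel_measurable borel"
  shows "translation_modulus f h \<le> 2 * (\<integral>\<^sup>+x. ennreal \<bar>f x\<bar> \<partial>lborel)"
  using translation_modulus_le_add[of f "\<lambda>_. 0" h] by (simp add: translation_modulus_def)

lemma ennreal_tendsto_0I:
  fixes f :: "'b \<Rightarrow> ennreal"
  assumes "\<And>e. 0 < e \<Longrightarrow> eventually (\<lambda>x. f x \<le> ennreal e) F"
  shows "(f \<longlongrightarrow> 0) F"
proof (rule order_tendstoI)
  fix a :: ennreal assume "0 < a"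
  then obtain e where e: "0 < e" "ennreal e < a"
    by (metis dense ennreal_cases ennreal_less_zero_iff infinity_ennreal_def not_less_iff_gr_or_eq top_neq_ennreal ennreal_less_top less_trans)
  show "\<forall>\<^sub>F x in F. f x < a"
    using assms[OF e(1)] by eventually_elim (use e(2) in auto)
qed auto

lemma translation_modulus_approx:
  fixes f :: "'a::euclidean_space \<Rightarrow> real"
  assumes [measurable]: "f \<in> borel_measurable borel" and h: "h \<longlonglongrightarrow> 0"
    and approx: "\<And>e. 0 < e \<Longrightarrow> \<exists>g\<in>borel_measurable borel.
      (\<integral>\<^sup>+x. ennreal \<bar>f x - g x\<bar> \<partial>lborel) \<le> ennreal e \<and> (\<lambda>n. translation_modulus g (h n)) \<longlonglongrightarrow> 0"
  shows "(\<lambda>n. translation_modulus f (h n)) \<longlonglongrightarrow> 0"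
proof (rule ennreal_tendsto_0I)
  fix e :: real assume e: "0 < e"
  obtain g where [measurable]: "g \<in> borel_measurable borel"
    and g: "(\<integral>\<^sup>+x. ennreal \<bar>f x - g x\<bar> \<partial>lborel) \<le> ennreal (e/4)" "(\<lambda>n. translation_modulus g (h n)) \<longlonglongrightarrow> 0"
    using approx[of "e/4"] e by auto
  have "eventually (\<lambda>n. translation_modulus g (h n) < ennreal (e/2)) sequentially"
    using g(2) e by (intro order_tendstoD) auto
  then show "\<forall>\<^sub>F n in sequentially. translation_modulus f (h n) \<le> ennreal e"
  proof eventually_elim
    case (elim n)
    have "translation_modulus f (h n) \<le> ennreal (e/2) + 2 * ennreal (e/4)"
      using elim g(1)
      by (intro order_trans[OF translation_modulus_le_add[of f g]] add_mono mult_left_mono) auto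
    also have "\<dots> = ennreal (e/2) + ennreal (2 * (e/4))"
      using ennreal_mult[of 2 "e/4"] e by simp
    also have "\<dots> = ennreal e" using e by (simp flip: ennreal_plus)
    finally show ?case .
  qed
qed

text \<open>
  For a point \<open>x\<close> of the open set \<open>U\<close> also \<open>x - h\<close> lies in \<open>U\<close> once \<open>h\<close> is small, so the positive part of
  \<open>1\<^sub>U(x) - 1\<^sub>U(x - h)\<close> tends to 0 pointwise; it is dominated by \<open>1\<^sub>U\<close>. The two indicators have the
  same integral, hence the negative part has the same integral as the positive part.
\<close>

lemma translation_modulus_open:
  fixes U :: "'a::euclidean_space set"
  assumes U: "open U" "emeasure lborel U < \<infinity>" and h: "h \<longlonglongrightarrow> 0"
  shows "(\<lambda>n. translation_modulus (indicator U) (h n)) \<longlonglongrightarrow> 0"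
proof -
  have [measurable]: "U \<in> sets borel" using U by auto
  have iU: "integrable lborel (indicator U :: 'a \<Rightarrow> real)" using U by (intro integrable_real_indicator) auto
  define g where "g n x = max 0 (indicator U x - indicator U (x - h n) :: real)" for n x
  have g: "integrable lborel (g n)" for n
    unfolding g_def using iU integrable_lborel_translate[OF iU] by auto
  have "(\<lambda>n. LINT x|lborel. g n x) \<longlonglongrightarrow> integral\<^sup>L lborel (\<lambda>x::'a. 0::real)"
  proof (rule integral_dominated_convergence[where w="indicator U"])
    show "AE x in lborel. (\<lambda>n. g n x) \<longlonglongrightarrow> 0"
    proof (rule AE_I2)
      fix x
      show "(\<lambda>n. g n x) \<longlonglongrightarrow> 0"
      proof (cases "x \<in> U")
        case True
        have "(\<lambda>n. x - h n) \<longlonglongrightarrow> x - 0" using h by (intro tendsto_intros)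
        then have "eventually (\<lambda>n. x - h n \<in> U) sequentially"
          using U True by (auto simp: tendsto_def)
        then have "eventually (\<lambda>n. g n x = 0) sequentially"
          by eventually_elim (auto simp: g_def)
        then show ?thesis by (rule tendsto_eventually)
      next
        case False
        then have "g n x = 0" for n by (auto simp: g_def indicator_def)
        then show ?thesis by simp
      qed
    qed
  qed (use iU g in \<open>auto simp: g_def indicator_def\<close>)
  then have lim: "(\<lambda>n. ennreal (2 * (LINT x|lborel. g n x))) \<longlonglongrightarrow> ennreal (2 * 0)"
    by (intro tendsto_intros tendsto_ennrealI) simp
  have "translation_modulus (indicator U) (h n) = ennreal (2 * (LINT x|lborel. g n x))" for n
  proof -
    (* The absolute value is twice the positive part minus the signed difference, which integrates to 0. *)
    have eq: "\<bar>indicator U (x - h n) - indicator U x\<bar> = 2 * g n x - (indicator U x - indicator U (x - h n) :: real)" for x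
      by (simp add: g_def max_def abs_if)
    have "(LINT x|lborel. indicator U (x - h n) :: real) = (LINT x|lborel. indicator U x)"
      by (rule lborel_integral_translate) measurable
    then have "(LINT x|lborel. \<bar>indicator U (x - h n) - indicator U x :: real\<bar>) = 2 * (LINT x|lborel. g n x)"
      unfolding eq using iU integrable_lborel_translate[OF iU, of "h n"] g[of n]
      by (simp add: Bochner_Integration.integral_diff)
    moreover have "translation_modulus (indicator U) (h n)
       = ennreal (LINT x|lborel. \<bar>indicator U (x - h n) - indicator U x :: real\<bar>)"
      unfolding translation_modulus_def
      using iU integrable_lborel_translate[OF iU, of "h n"] by (intro nn_integral_eq_integral) auto
    ultimately show ?thesis by simp
  qed
  then show ?thesis using lim by simp
qed

text \<open>
  Outer regularity approximates indicators of sets of finite measure by indicators of open sets. The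
  modulus is subadditive and Lipschitz with constant 2 for the \<open>L\<^sup>1\<close> norm, so the property passes to
  sums and to limits in \<open>L\<^sup>1\<close>.
\<close>

lemma translation_modulus_tendsto:
  fixes f :: "'a::euclidean_space \<Rightarrow> real"
  assumes "integrable lborel f" and h: "h \<longlonglongrightarrow> 0"
  shows "(\<lambda>n. translation_modulus f (h n)) \<longlonglongrightarrow> 0"
  using assms(1)
proof (induction rule: integrable_induct)
  case (base A c)
  then have [measurable]: "A \<in> sets borel" by simp
  have "(\<lambda>n. translation_modulus (indicator A) (h n)) \<longlonglongrightarrow> 0"
  proof (rule translation_modulus_approx[OF _ h])
    fix e :: real assume e: "0 < e"
    obtain U where U: "open U" "A \<subseteq> U" "U - A \<in> lmeasurable" "emeasure lebesgue (U - A) < ennreal e"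
      using sets_lebesgue_outer_open[of A e] e base by (metis sets_completionI_sets)
    have [measurable]: "U \<in> sets borel" using U by auto
    have UA: "emeasure lborel (U - A) < ennreal e" using U by simp
    have "emeasure lborel U \<le> emeasure lborel A + emeasure lborel (U - A)"
      using emeasure_subadditive[of A lborel "U - A"] U by (auto simp: Un_absorb1 Un_Diff_cancel)
    also have "\<dots> < \<infinity>" using base UA by (auto simp: less_top[symmetric])
    finally have fin: "emeasure lborel U < \<infinity>" .
    have "(\<integral>\<^sup>+x. ennreal \<bar>indicator A x - indicator U x\<bar> \<partial>lborel) = (\<integral>\<^sup>+x. indicator (U - A) x \<partial>lborel)"
      using U by (intro nn_integral_cong) (auto simp: indicator_def)
    also have "\<dots> \<le> ennreal e" using UA by (simp add: less_imp_le)
    finally show "\<exists>g\<in>borel_measurable borel.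
      (\<integral>\<^sup>+x. ennreal \<bar>indicator A x - g x\<bar> \<partial>lborel) \<le> ennreal e \<and> (\<lambda>n. translation_modulus g (h n)) \<longlonglongrightarrow> 0"
      using translation_modulus_open[OF U(1) fin h] by (intro bexI[of _ "indicator U"]) auto
  qed measurable
  then have "(\<lambda>n. ennreal \<bar>c\<bar> * translation_modulus (indicator A) (h n)) \<longlonglongrightarrow> ennreal \<bar>c\<bar> * 0"
    by (intro ennreal_tendsto_cmult) auto
  moreover have "ennreal \<bar>c\<bar> * translation_modulus (indicator A) (h n) = translation_modulus (\<lambda>x. indicator A x *\<^sub>R c) (h n)" for n
    unfolding translation_modulus_def
    by (subst nn_integral_cmult[symmetric])
       (auto simp flip: ennreal_mult' intro!: nn_integral_cong simp: indicator_def abs_mult)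
  ultimately show ?case by simp
next
  case (add f g)
  then have [measurable]: "f \<in> borel_measurable borel" "g \<in> borel_measurable borel" by auto
  have "(\<lambda>n. translation_modulus f (h n) + translation_modulus g (h n)) \<longlonglongrightarrow> 0 + 0"
    using add by (intro tendsto_intros)
  moreover have "translation_modulus (\<lambda>x. f x + g x) k \<le> translation_modulus f k + translation_modulus g k" for k
    unfolding translation_modulus_def
    by (subst nn_integral_add[symmetric])
       (auto simp flip: ennreal_plus intro!: nn_integral_mono ennreal_leI)
  ultimately show ?case
    by (intro tendsto_sandwich[OF _ _ tendsto_const, of 0 "\<lambda>n. translation_modulus (\<lambda>x. f x + g x) (h n)"]) auto
next
  case (lim f s)
  have [measurable]: "f \<in> borel_measurable borel" "\<And>i. s i \<in> borel_measurable borel" using lim by auto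
  have conv: "(\<lambda>i. \<integral>\<^sup>+x. ennreal (norm (f x - s i x)) \<partial>lborel) \<longlonglongrightarrow> 0"
  proof (rule nn_integral_dominated_convergence_norm[where w="\<lambda>x. 2 * norm (f x)"])
    have "integrable lborel (\<lambda>x. 2 * norm (f x))" using lim by simp
    then show "(\<integral>\<^sup>+x. ennreal (2 * norm (f x)) \<partial>lborel) < \<infinity>"
      by (simp add: nn_integral_eq_integral)
  qed (use lim in auto)
  show ?case
  proof (rule translation_modulus_approx[OF _ h])
    fix e :: real assume "0 < e"
    then have "eventually (\<lambda>i. (\<integral>\<^sup>+x. ennreal (norm (f x - s i x)) \<partial>lborel) < ennreal e) sequentially"
      using conv by (intro order_tendstoD) auto
    then obtain i where "(\<integral>\<^sup>+x. ennreal (norm (f x - s i x)) \<partial>lborel) < ennreal e"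
      by (auto simp: eventually_sequentially)
    then show "\<exists>g\<in>borel_measurable borel.
      (\<integral>\<^sup>+x. ennreal \<bar>f x - g x\<bar> \<partial>lborel) \<le> ennreal e \<and> (\<lambda>n. translation_modulus g (h n)) \<longlonglongrightarrow> 0"
      using lim by (intro bexI[of _ "s i"]) auto
  qed simp
qed

section \<open>Averages of translates in \<open>L\<^sup>q\<close>\<close>

text \<open>
  Convexity of \<open>x \<mapsto> x\<^sup>q\<close>: the graph lies above its tangent at \<open>m\<close>. At \<open>m = 0\<close> the convention
  \<open>0 powr 0 = 0\<close> makes the slope vanish also for \<open>q = 1\<close>, which is harmless for \<open>x \<ge> 0\<close>.
\<close>

lemma powr_tangent_le:
  fixes x m q :: real
  assumes "0 \<le> x" "0 \<le> m" "1 \<le> q"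
  shows "m powr q + q * m powr (q - 1) * (x - m) \<le> x powr q"
proof (cases "m = 0 \<or> x = 0")
  case True
  then show ?thesis
  proof
    assume x: "x = 0"
    have "m powr (q - 1) * m = m powr q"
      using assms by (cases "m = 0") (auto simp: powr_mult_base mult.commute)
    then have "m powr q + q * m powr (q - 1) * (x - m) = (1 - q) * m powr q"
      using x by (simp add: algebra_simps)
    also have "\<dots> \<le> 0" using assms by (intro mult_nonpos_nonneg) auto
    finally show ?thesis using x by simp
  qed (use assms in auto)
next
  case False
  then have pos: "0 < m" "0 < x" using assms by auto
  have "((x / m) powr q) powr (1 / q) * 1 powr (1 - 1 / q) \<le> 1 / q * (x / m) powr q + (1 - 1 / q) * 1"
    using assms pos by (intro Youngs_inequality_0) (auto simp: field_simps)
  then have young: "x / m \<le> 1 / q * (x / m) powr q + (1 - 1 / q)"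
    using assms pos by (simp add: powr_powr)
  have "1 + q * (x / m - 1) \<le> (x / m) powr q"
  proof -
    have "q * (x / m) \<le> q * (1 / q * (x / m) powr q + (1 - 1 / q))"
      using young assms by (intro mult_left_mono) auto
    also have "\<dots> = (x / m) powr q + q - 1" using assms by (simp add: distrib_left right_diff_distrib)
    finally show ?thesis by (simp add: right_diff_distrib)
  qed
  then have "m powr q * (1 + q * (x / m - 1)) \<le> m powr q * (x / m) powr q"
    by (intro mult_left_mono) auto
  moreover have "m powr q * (x / m) powr q = x powr q"
    using pos by (simp add: powr_divide)
  moreover have "m powr q * (1 + q * (x / m - 1)) = m powr q + q * m powr (q - 1) * (x - m)"
    using pos by (simp add: powr_diff field_simps)
  ultimately show ?thesis by simp
qed

lemma integrable_mult_of_powr: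
  fixes F K :: "'b \<Rightarrow> real"
  assumes [measurable]: "F \<in> borel_measurable M" and K: "integrable M K" and q: "1 \<le> q"
    and FK: "integrable M (\<lambda>z. \<bar>F z\<bar> powr q * \<bar>K z\<bar>)"
  shows "integrable M (\<lambda>z. F z * K z)"
proof (rule Bochner_Integration.integrable_bound)
  show "integrable M (\<lambda>z. \<bar>K z\<bar> + \<bar>F z\<bar> powr q * \<bar>K z\<bar>)" using K FK by auto
  have [measurable]: "K \<in> borel_measurable M" using K by auto
  show "(\<lambda>z. F z * K z) \<in> borel_measurable M" by measurable
  show "AE z in M. norm (F z * K z) \<le> norm (\<bar>K z\<bar> + \<bar>F z\<bar> powr q * \<bar>K z\<bar>)"
  proof (rule AE_I2)
    fix z
    have "\<bar>F z\<bar> \<le> 1 + \<bar>F z\<bar> powr q"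
      using powr_mono[of 1 q "\<bar>F z\<bar>"] q by (cases "\<bar>F z\<bar> \<le> 1") (auto intro: order_trans simp: add_increasing)
    then have "\<bar>F z\<bar> * \<bar>K z\<bar> \<le> (1 + \<bar>F z\<bar> powr q) * \<bar>K z\<bar>" by (intro mult_right_mono) auto
    then show "norm (F z * K z) \<le> norm (\<bar>K z\<bar> + \<bar>F z\<bar> powr q * \<bar>K z\<bar>)"
      by (simp add: abs_mult distrib_right)
  qed
qed

text \<open>
  Jensen's inequality for the finite measure with density \<open>\<bar>K\<bar>\<close>: integrate the tangent inequality
  at the mean of \<open>\<bar>F\<bar>\<close> with respect to this measure.
\<close>

lemma powr_integral_mult_le:
  fixes F K :: "'b \<Rightarrow> real"
  assumes [measurable]: "F \<in> borel_measurable M" and K: "integrable M K" and q: "1 \<le> q"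
    and FK: "integrable M (\<lambda>z. \<bar>F z\<bar> powr q * \<bar>K z\<bar>)"
  shows "\<bar>LINT z|M. F z * K z\<bar> powr q
     \<le> (LINT z|M. \<bar>K z\<bar>) powr (q - 1) * (LINT z|M. \<bar>F z\<bar> powr q * \<bar>K z\<bar>)"
proof -
  have [measurable]: "K \<in> borel_measurable M" using K by auto
  define k where "k = (LINT z|M. \<bar>K z\<bar>)"
  have k0: "0 \<le> k" unfolding k_def by (intro integral_nonneg_AE) auto
  show ?thesis
  proof (cases "k = 0")
    case True
    then have "AE z in M. K z = 0"
      using K integral_nonneg_eq_0_iff_AE[of M "\<lambda>z. \<bar>K z\<bar>"] by (auto simp: k_def)
    then have "(LINT z|M. F z * K z) = (LINT z|M. 0)"
      by (intro integral_cong_AE) auto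
    then show ?thesis by (auto intro!: mult_nonneg_nonneg integral_nonneg_AE)
  next
    case False
    then have k: "0 < k" using k0 by simp
    have iFK: "integrable M (\<lambda>z. \<bar>F z\<bar> * \<bar>K z\<bar>)"
      using integrable_abs[OF integrable_mult_of_powr[OF assms]] by (simp add: abs_mult)
    (* m is the mean of \<bar>F\<bar> for the normalised measure, and a the slope of the tangent there. *)
    define m where "m = (LINT z|M. \<bar>F z\<bar> * \<bar>K z\<bar>) / k"
    have m: "0 \<le> m" unfolding m_def using k by (auto intro!: divide_nonneg_nonneg integral_nonneg_AE)
    define a where "a = q * m powr (q - 1)"
    have mk: "(LINT z|M. \<bar>F z\<bar> * \<bar>K z\<bar>) = m * k" using k by (simp add: m_def)
    have "(LINT z|M. (m powr q - a * m) * \<bar>K z\<bar> + a * (\<bar>F z\<bar> * \<bar>K z\<bar>)) \<le> (LINT z|M. \<bar>F z\<bar> powr q * \<bar>K z\<bar>)"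
    proof (intro integral_mono)
      fix z
      have "(m powr q + a * (\<bar>F z\<bar> - m)) * \<bar>K z\<bar> \<le> \<bar>F z\<bar> powr q * \<bar>K z\<bar>"
        unfolding a_def using m q by (intro mult_right_mono powr_tangent_le) auto
      then show "(m powr q - a * m) * \<bar>K z\<bar> + a * (\<bar>F z\<bar> * \<bar>K z\<bar>) \<le> \<bar>F z\<bar> powr q * \<bar>K z\<bar>"
        by (simp add: algebra_simps)
    qed (use K FK iFK in auto)
    also have "(LINT z|M. (m powr q - a * m) * \<bar>K z\<bar> + a * (\<bar>F z\<bar> * \<bar>K z\<bar>))
        = (m powr q - a * m) * k + a * (m * k)"
      using K iFK by (simp add: k_def[symmetric] mk)
    also have "\<dots> = m powr q * k" by (simp add: algebra_simps)
    finally have main: "m powr q * k \<le> (LINT z|M. \<bar>F z\<bar> powr q * \<bar>K z\<bar>)" .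
    have "\<bar>LINT z|M. F z * K z\<bar> \<le> m * k"
      using integral_norm_bound[of M "\<lambda>z. F z * K z"] by (simp add: abs_mult mk)
    then have "\<bar>LINT z|M. F z * K z\<bar> powr q \<le> (m * k) powr q" using q by (intro powr_mono2) auto
    also have "\<dots> = k powr (q - 1) * (m powr q * k)"
      using k m by (simp add: powr_mult powr_diff)
    also have "\<dots> \<le> k powr (q - 1) * (LINT z|M. \<bar>F z\<bar> powr q * \<bar>K z\<bar>)"
      using main by (intro mult_left_mono) auto
    finally show ?thesis by (simp add: k_def)
  qed
qed

text \<open>
  Jensen's inequality for each \<open>x\<close>, followed by Tonelli's theorem. With \<open>P x z = f (x - z)\<close> this is
  Young's convolution inequality; differences of two translates of \<open>f\<close> are the other use.
\<close>

lemma average_powr_bound: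
  fixes P :: "'a::euclidean_space \<Rightarrow> 'b::euclidean_space \<Rightarrow> real"
  assumes P [measurable]: "(\<lambda>(x, z). P x z) \<in> borel_measurable borel"
    and K: "integrable lborel K" and q: "1 \<le> q"
    and fin: "(\<integral>\<^sup>+z. ennreal \<bar>K z\<bar> * (\<integral>\<^sup>+x. ennreal (\<bar>P x z\<bar> powr q) \<partial>lborel) \<partial>lborel) < \<infinity>"
  shows "AE x in lborel. integrable lborel (\<lambda>z. P x z * K z)"
    and "(\<integral>\<^sup>+x. ennreal (\<bar>LINT z|lborel. P x z * K z\<bar> powr q) \<partial>lborel)
       \<le> ennreal ((LINT z|lborel. \<bar>K z\<bar>) powr (q - 1)) *
          (\<integral>\<^sup>+z. ennreal \<bar>K z\<bar> * (\<integral>\<^sup>+x. ennreal (\<bar>P x z\<bar> powr q) \<partial>lborel) \<partial>lborel)"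
proof -
  have [measurable]: "K \<in> borel_measurable borel" using K by auto
  have P1 [measurable]: "(\<lambda>w. P (f w) (g w)) \<in> borel_measurable M"
    if [measurable]: "f \<in> borel_measurable M" "g \<in> borel_measurable M" for f g and M :: "'c measure"
    using measurable_compose[OF borel_measurable_Pair[OF that] P] by simp
  have P2 [measurable]: "(\<lambda>w. P (fst w) (snd w)) \<in> borel_measurable (lborel \<Otimes>\<^sub>M lborel)"
    using P by (simp add: lborel_prod case_prod_beta')
  define R where "R = (\<integral>\<^sup>+z. ennreal \<bar>K z\<bar> * (\<integral>\<^sup>+x. ennreal (\<bar>P x z\<bar> powr q) \<partial>lborel) \<partial>lborel)"
  have Px [measurable]: "P x \<in> borel_measurable borel" for x
    by (rule P1) auto
  have "R = (\<integral>\<^sup>+z. (\<integral>\<^sup>+x. ennreal (\<bar>P x z\<bar> powr q * \<bar>K z\<bar>) \<partial>lborel) \<partial>lborel)"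
    unfolding R_def
    by (intro nn_integral_cong, subst nn_integral_cmult[symmetric])
       (auto simp: ennreal_mult' mult.commute)
  also have "\<dots> = (\<integral>\<^sup>+x. (\<integral>\<^sup>+z. ennreal (\<bar>P x z\<bar> powr q * \<bar>K z\<bar>) \<partial>lborel) \<partial>lborel)"
    by (rule lborel_pair.Fubini') (simp add: case_prod_beta')
  finally have R: "R = (\<integral>\<^sup>+x. (\<integral>\<^sup>+z. ennreal (\<bar>P x z\<bar> powr q * \<bar>K z\<bar>) \<partial>lborel) \<partial>lborel)" .
  have "AE x in lborel. (\<integral>\<^sup>+z. ennreal (\<bar>P x z\<bar> powr q * \<bar>K z\<bar>) \<partial>lborel) \<noteq> \<infinity>"
    using fin unfolding R_def[symmetric] R by (intro nn_integral_PInf_AE) auto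
  then have AEi: "AE x in lborel. integrable lborel (\<lambda>z. \<bar>P x z\<bar> powr q * \<bar>K z\<bar>)"
    by eventually_elim (auto simp: integrable_iff_bounded less_top abs_mult)
  then show "AE x in lborel. integrable lborel (\<lambda>z. P x z * K z)"
    by eventually_elim (use K q in \<open>auto intro: integrable_mult_of_powr\<close>)
  have "(\<integral>\<^sup>+x. ennreal (\<bar>LINT z|lborel. P x z * K z\<bar> powr q) \<partial>lborel)
     \<le> (\<integral>\<^sup>+x. ennreal ((LINT z|lborel. \<bar>K z\<bar>) powr (q - 1)) *
          (\<integral>\<^sup>+z. ennreal (\<bar>P x z\<bar> powr q * \<bar>K z\<bar>) \<partial>lborel) \<partial>lborel)"
  proof (rule nn_integral_mono_AE, use AEi in eventually_elim)
    case (elim x)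
    show ?case
      using powr_integral_mult_le[OF _ K q elim] elim
      by (simp add: nn_integral_eq_integral ennreal_mult'[symmetric] ennreal_leI)
  qed
  also have "\<dots> = ennreal ((LINT z|lborel. \<bar>K z\<bar>) powr (q - 1)) * R"
    unfolding R by (rule nn_integral_cmult) measurable
  finally show "(\<integral>\<^sup>+x. ennreal (\<bar>LINT z|lborel. P x z * K z\<bar> powr q) \<partial>lborel)
       \<le> ennreal ((LINT z|lborel. \<bar>K z\<bar>) powr (q - 1)) *
          (\<integral>\<^sup>+z. ennreal \<bar>K z\<bar> * (\<integral>\<^sup>+x. ennreal (\<bar>P x z\<bar> powr q) \<partial>lborel) \<partial>lborel)"
    by (simp add: R_def)
qed

lemma measurable_translation_modulus [measurable]:
  assumes [measurable]: "f \<in> borel_measurable borel"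
  shows "translation_modulus f \<in> borel_measurable borel"
  unfolding translation_modulus_def by measurable

text \<open>
  Dominated convergence: the modulus never exceeds twice the \<open>L\<^sup>1\<close> norm of \<open>f\<close>.
\<close>

lemma averaged_translation_modulus_tendsto:
  fixes f K :: "'a::euclidean_space \<Rightarrow> real"
  assumes f: "integrable lborel f" and K: "integrable lborel K" and c: "c \<longlonglongrightarrow> (0::real)"
  shows "(\<lambda>n. \<integral>\<^sup>+z. ennreal \<bar>K z\<bar> * translation_modulus f (c n *\<^sub>R z) \<partial>lborel) \<longlonglongrightarrow> 0"
proof -
  have [measurable]: "f \<in> borel_measurable borel" "K \<in> borel_measurable borel" using f K by auto
  define A where "A = (\<integral>\<^sup>+x. ennreal \<bar>f x\<bar> \<partial>lborel)"
  have A: "A < \<infinity>" using f by (auto simp: A_def integrable_iff_bounded)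
  have "(\<lambda>n. \<integral>\<^sup>+z. ennreal \<bar>K z\<bar> * translation_modulus f (c n *\<^sub>R z) \<partial>lborel) \<longlonglongrightarrow> integral\<^sup>N lborel (\<lambda>z::'a. 0)"
  proof (rule nn_integral_dominated_convergence[where w="\<lambda>z. ennreal \<bar>K z\<bar> * (2 * A)"])
    show "AE z in lborel. ennreal \<bar>K z\<bar> * translation_modulus f (c j *\<^sub>R z) \<le> ennreal \<bar>K z\<bar> * (2 * A)" for j
      unfolding A_def by (intro AE_I2 mult_left_mono translation_modulus_le_norm) auto
    have "(\<integral>\<^sup>+z. ennreal \<bar>K z\<bar> * (2 * A) \<partial>lborel) = (\<integral>\<^sup>+z. ennreal \<bar>K z\<bar> \<partial>lborel) * (2 * A)"
      by (rule nn_integral_multc) measurable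
    also have "\<dots> < \<infinity>" using A K by (auto simp: integrable_iff_bounded ennreal_mult_less_top)
    finally show "(\<integral>\<^sup>+z. ennreal \<bar>K z\<bar> * (2 * A) \<partial>lborel) < \<infinity>" .
    show "AE z in lborel. (\<lambda>i. ennreal \<bar>K z\<bar> * translation_modulus f (c i *\<^sub>R z)) \<longlonglongrightarrow> 0"
    proof (rule AE_I2)
      fix z :: 'a
      have "(\<lambda>i. c i *\<^sub>R z) \<longlonglongrightarrow> 0 *\<^sub>R z" using c by (intro tendsto_intros)
      then have "(\<lambda>i. translation_modulus f (c i *\<^sub>R z)) \<longlonglongrightarrow> 0"
        using f by (intro translation_modulus_tendsto) auto
      then have "(\<lambda>i. ennreal \<bar>K z\<bar> * translation_modulus f (c i *\<^sub>R z)) \<longlonglongrightarrow> ennreal \<bar>K z\<bar> * 0"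
        by (intro ennreal_tendsto_cmult) auto
      then show "(\<lambda>i. ennreal \<bar>K z\<bar> * translation_modulus f (c i *\<^sub>R z)) \<longlonglongrightarrow> 0" by simp
    qed
  qed measurable
  then show ?thesis by simp
qed

lemma nn_integral_abs_diff_translates:
  fixes f :: "'a::euclidean_space \<Rightarrow> real"
  assumes [measurable]: "f \<in> borel_measurable borel"
  shows "(\<integral>\<^sup>+x. ennreal \<bar>f (x - a) - f (x - b)\<bar> \<partial>lborel) = translation_modulus f (a - b)"
  using nn_integral_lborel_translate[of "\<lambda>x. ennreal \<bar>f (x - (a - b)) - f x\<bar>" b]
  by (simp add: translation_modulus_def algebra_simps)

text \<open>
  For \<open>c > 0\<close> this is the convolution of \<open>f\<close> with the dilated kernel \<open>c\<^sup>-\<^sup>N K(\<cdot>/c)\<close>. In this form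
  \<open>c = 0\<close> is not exceptional: the average is then \<open>f\<close> times the integral of \<open>K\<close>. Continuity in \<open>c\<close>
  thereby covers continuity in time and attainment of initial data at once.
\<close>

definition dilation_average :: "('a::euclidean_space \<Rightarrow> real) \<Rightarrow> ('a \<Rightarrow> real) \<Rightarrow> real \<Rightarrow> 'a \<Rightarrow> real" where
  "dilation_average K f c x = (LINT z|lborel. f (x - c *\<^sub>R z) * K z)"

lemma dilation_average_measurable [measurable]:
  assumes [measurable]: "f \<in> borel_measurable borel" "K \<in> borel_measurable borel"
  shows "dilation_average K f c \<in> borel_measurable borel"
  unfolding dilation_average_def by measurable

lemma in_Lm_iff:
  "in_Lm m f \<longleftrightarrow> f \<in> borel_measurable borel \<and> (\<integral>\<^sup>+x. ennreal (\<bar>f x\<bar> powr m) \<partial>lborel) < \<infinity>"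
  unfolding in_Lm_def by (auto simp: integrable_iff_bounded)

lemma dilation_average_bound:
  fixes f K :: "'a::euclidean_space \<Rightarrow> real"
  assumes f: "in_Lm q f" and K: "integrable lborel K" and q: "1 \<le> q"
  shows "AE x in lborel. integrable lborel (\<lambda>z. f (x - c *\<^sub>R z) * K z)" (is ?int)
    and "(\<integral>\<^sup>+x. ennreal (\<bar>dilation_average K f c x\<bar> powr q) \<partial>lborel)
      \<le> ennreal ((LINT z|lborel. \<bar>K z\<bar>) powr (q - 1)) *
         ((\<integral>\<^sup>+z. ennreal \<bar>K z\<bar> \<partial>lborel) * (\<integral>\<^sup>+x. ennreal (\<bar>f x\<bar> powr q) \<partial>lborel))" (is ?bound)
    and "in_Lm q (dilation_average K f c)" (is ?in)
proof -
  have [measurable]: "f \<in> borel_measurable borel" "K \<in> borel_measurable borel" 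
    using f K by (auto simp: in_Lm_iff)
  have tr: "(\<integral>\<^sup>+x. ennreal (\<bar>f (x - c *\<^sub>R z)\<bar> powr q) \<partial>lborel) = (\<integral>\<^sup>+x. ennreal (\<bar>f x\<bar> powr q) \<partial>lborel)" for z
    by (rule nn_integral_lborel_translate[of "\<lambda>x. ennreal (\<bar>f x\<bar> powr q)"]) measurable
  have eq: "(\<integral>\<^sup>+z. ennreal \<bar>K z\<bar> * (\<integral>\<^sup>+x. ennreal (\<bar>f (x - c *\<^sub>R z)\<bar> powr q) \<partial>lborel) \<partial>lborel)
     = (\<integral>\<^sup>+z. ennreal \<bar>K z\<bar> \<partial>lborel) * (\<integral>\<^sup>+x. ennreal (\<bar>f x\<bar> powr q) \<partial>lborel)"
    unfolding tr by (rule nn_integral_multc) measurable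
  have fin: "(\<integral>\<^sup>+z. ennreal \<bar>K z\<bar> \<partial>lborel) * (\<integral>\<^sup>+x. ennreal (\<bar>f x\<bar> powr q) \<partial>lborel) < \<infinity>"
    using f K by (auto simp: in_Lm_iff integrable_iff_bounded ennreal_mult_less_top)
  note b = average_powr_bound[of "\<lambda>x z. f (x - c *\<^sub>R z)" K q, unfolded eq, OF _ K q fin]
  show ?int by (rule b(1)) (unfold borel_prod[symmetric], measurable)
  show bd: ?bound unfolding dilation_average_def by (rule b(2)) (unfold borel_prod[symmetric], measurable)
  show ?in
    unfolding in_Lm_iff
    using order.strict_trans1[OF bd] fin by (auto simp: ennreal_mult_less_top)
qed

text \<open>
  Pointwise in \<open>z\<close> the difference of the two translates of \<open>f\<close> is controlled in \<open>L\<^sup>q\<close> by the \<open>L\<^sup>1\<close> modulus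
  of the signed power of \<open>f\<close> at the shift \<open>(c\<^sub>n - c\<^sub>0) z\<close>, and this tends to 0 on average over \<open>z\<close>.
\<close>

lemma dilation_average_tendsto:
  fixes f K :: "'a::euclidean_space \<Rightarrow> real"
  assumes f: "in_Lm q f" and K: "integrable lborel K" and q: "1 \<le> q" and c: "c \<longlonglongrightarrow> c0"
  shows "(\<lambda>n. \<integral>\<^sup>+x. ennreal (\<bar>dilation_average K f (c n) x - dilation_average K f c0 x\<bar> powr q) \<partial>lborel) \<longlonglongrightarrow> 0"
proof -
  have [measurable]: "f \<in> borel_measurable borel" "K \<in> borel_measurable borel" 
    using f K by (auto simp: in_Lm_iff)
  define g where "g x = signed_powr q (f x)" for x
  have [measurable]: "g \<in> borel_measurable borel" unfolding g_def by measurable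
  have g: "integrable lborel g"
    using f by (simp add: in_Lm_iff integrable_iff_bounded g_def)
  define k where "k = ennreal ((LINT z|lborel. \<bar>K z\<bar>) powr (q - 1))"
  define J where "J n = (\<integral>\<^sup>+z. ennreal \<bar>K z\<bar> * translation_modulus g ((c n - c0) *\<^sub>R z) \<partial>lborel)" for n
  define A where "A = (\<integral>\<^sup>+x. ennreal \<bar>g x\<bar> \<partial>lborel)"
  have A: "A < \<infinity>" using g by (auto simp: A_def integrable_iff_bounded)
  have "J \<longlonglongrightarrow> 0"
    unfolding J_def using c by (intro averaged_translation_modulus_tendsto g K) (simp add: LIM_zero)
  then have lim: "(\<lambda>n. k * (ennreal (2 powr q) * J n)) \<longlonglongrightarrow> k * (ennreal (2 powr q) * 0)"
    by (intro ennreal_tendsto_cmult) (auto simp: k_def)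
  have J_fin: "J n < \<infinity>" for n
  proof -
    have "J n \<le> (\<integral>\<^sup>+z. ennreal \<bar>K z\<bar> * (2 * A) \<partial>lborel)"
      unfolding J_def A_def by (intro nn_integral_mono mult_left_mono translation_modulus_le_norm) auto
    also have "\<dots> = (\<integral>\<^sup>+z. ennreal \<bar>K z\<bar> \<partial>lborel) * (2 * A)"
      by (rule nn_integral_multc) measurable
    also have "\<dots> < \<infinity>" using A K by (auto simp: integrable_iff_bounded ennreal_mult_less_top)
    finally show ?thesis .
  qed
  have "(\<integral>\<^sup>+x. ennreal (\<bar>dilation_average K f (c n) x - dilation_average K f c0 x\<bar> powr q) \<partial>lborel)
      \<le> k * (ennreal (2 powr q) * J n)" for n
  proof -
    define P where "P x z = f (x - c n *\<^sub>R z) - f (x - c0 *\<^sub>R z)" for x z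
    have P [measurable]: "(\<lambda>(x, z). P x z) \<in> borel_measurable borel"
      unfolding P_def borel_prod[symmetric] by measurable
    have "(\<integral>\<^sup>+x. ennreal (\<bar>P x z\<bar> powr q) \<partial>lborel) \<le> ennreal (2 powr q) * translation_modulus g ((c n - c0) *\<^sub>R z)" for z
    proof -
      have "(\<integral>\<^sup>+x. ennreal (\<bar>P x z\<bar> powr q) \<partial>lborel)
         \<le> (\<integral>\<^sup>+x. ennreal (2 powr q) * ennreal \<bar>g (x - c n *\<^sub>R z) - g (x - c0 *\<^sub>R z)\<bar> \<partial>lborel)"
        unfolding P_def g_def
        by (intro nn_integral_mono) (auto simp: ennreal_mult'[symmetric] intro!: ennreal_leI abs_diff_powr_le_signed_powr q)
      also have "\<dots> = ennreal (2 powr q) * translation_modulus g ((c n - c0) *\<^sub>R z)"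
        by (subst nn_integral_cmult) (auto simp: nn_integral_abs_diff_translates scaleR_left_diff_distrib)
      finally show ?thesis .
    qed
    then have "(\<integral>\<^sup>+z. ennreal \<bar>K z\<bar> * (\<integral>\<^sup>+x. ennreal (\<bar>P x z\<bar> powr q) \<partial>lborel) \<partial>lborel)
       \<le> (\<integral>\<^sup>+z. ennreal (2 powr q) * (ennreal \<bar>K z\<bar> * translation_modulus g ((c n - c0) *\<^sub>R z)) \<partial>lborel)"
      by (intro nn_integral_mono) (auto simp: mult.left_commute intro!: mult_left_mono)
    also have "\<dots> = ennreal (2 powr q) * J n"
      unfolding J_def by (rule nn_integral_cmult) measurable
    finally have le: "(\<integral>\<^sup>+z. ennreal \<bar>K z\<bar> * (\<integral>\<^sup>+x. ennreal (\<bar>P x z\<bar> powr q) \<partial>lborel) \<partial>lborel)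
       \<le> ennreal (2 powr q) * J n" .
    have "ennreal (2 powr q) * J n < \<infinity>" using J_fin by (simp add: ennreal_mult_less_top)
    note b = average_powr_bound(2)[OF P K q order.strict_trans1[OF le this]]
    have "AE x in lborel. dilation_average K f (c n) x - dilation_average K f c0 x = (LINT z|lborel. P x z * K z)"
      using dilation_average_bound(1)[OF f K q, of "c n"] dilation_average_bound(1)[OF f K q, of c0]
      by eventually_elim (simp add: dilation_average_def P_def left_diff_distrib)
    then have "AE x in lborel. ennreal (\<bar>dilation_average K f (c n) x - dilation_average K f c0 x\<bar> powr q)
        = ennreal (\<bar>LINT z|lborel. P x z * K z\<bar> powr q)"
      by eventually_elim simp
    then have "(\<integral>\<^sup>+x. ennreal (\<bar>dilation_average K f (c n) x - dilation_average K f c0 x\<bar> powr q) \<partial>lborel)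
      = (\<integral>\<^sup>+x. ennreal (\<bar>LINT z|lborel. P x z * K z\<bar> powr q) \<partial>lborel)"
      by (rule nn_integral_cong_AE)
    also have "\<dots> \<le> k * (ennreal (2 powr q) * J n)"
      unfolding k_def using b le by (meson mult_left_mono order_trans zero_le)
    finally show ?thesis .
  qed
  note le = this
  show ?thesis
  proof (rule tendsto_sandwich[OF _ _ tendsto_const])
    show "(\<lambda>n. k * (ennreal (2 powr q) * J n)) \<longlonglongrightarrow> 0" using lim by simp
  qed (use le in \<open>simp_all add: eventually_sequentiallyI\<close>)
qed

section \<open>Injectivity of the Fourier transform on \<open>L\<^sup>1\<close>\<close>

lemma nn_integral_lborel_affine:
  fixes F :: "'a::euclidean_space \<Rightarrow> ennreal"
  assumes [measurable]: "F \<in> borel_measurable borel" and c: "0 < c"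
  shows "(\<integral>\<^sup>+y. F y \<partial>lborel) = ennreal (c ^ DIM('a)) * (\<integral>\<^sup>+z. F (x - c *\<^sub>R z) \<partial>lborel)"
proof -
  have "(\<integral>\<^sup>+y. F y \<partial>lborel)
     = (\<integral>\<^sup>+y. F y \<partial>density (distr lborel borel (\<lambda>z. x + (- c) *\<^sub>R z)) (\<lambda>_. ennreal (\<bar>- c\<bar> ^ DIM('a))))"
    using c by (subst lborel_affine[of "- c" x]) (auto simp: ennreal_power)
  also have "\<dots> = ennreal (c ^ DIM('a)) * (\<integral>\<^sup>+z. F (x - c *\<^sub>R z) \<partial>lborel)"
    using c by (subst nn_integral_density, simp, simp, subst nn_integral_distr, simp, simp, subst nn_integral_cmult)
       simp_all
  finally show ?thesis .
qed

lemma lborel_integral_affine: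
  fixes F :: "'a::euclidean_space \<Rightarrow> 'b::{banach, second_countable_topology}"
  assumes [measurable]: "F \<in> borel_measurable borel" and c: "0 < c"
  shows "(LINT y|lborel. F y) = c ^ DIM('a) *\<^sub>R (LINT z|lborel. F (x - c *\<^sub>R z))"
proof -
  have "(LINT y|lborel. F y)
     = (LINT y|density (distr lborel borel (\<lambda>z. x + (- c) *\<^sub>R z)) (\<lambda>_. ennreal (\<bar>- c\<bar> ^ DIM('a))). F y)"
    using c by (subst lborel_affine[of "- c" x]) (auto simp: ennreal_power)
  also have "\<dots> = (LINT y|distr lborel borel (\<lambda>z. x + (- c) *\<^sub>R z). c ^ DIM('a) *\<^sub>R F y)"
    using c by (subst integral_density) auto
  also have "\<dots> = c ^ DIM('a) *\<^sub>R (LINT z|lborel. F (x - c *\<^sub>R z))"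
    by (simp add: integral_distr)
  finally show ?thesis .
qed

lemma integrable_lborel_affine:
  fixes F :: "'a::euclidean_space \<Rightarrow> 'b::{banach, second_countable_topology}"
  assumes F: "integrable lborel F" and c: "0 < c"
  shows "integrable lborel (\<lambda>z. F (x - c *\<^sub>R z))"
proof -
  have [measurable]: "F \<in> borel_measurable borel" using F by auto
  show ?thesis
    using F c nn_integral_lborel_affine[of "\<lambda>x. ennreal (norm (F x))" c x]
    by (auto simp: integrable_iff_bounded ennreal_mult_less_top)
qed

lemma lborel_prod_Basis:
  fixes f :: "'a::euclidean_space \<Rightarrow> real \<Rightarrow> 'b::{real_normed_field, banach, second_countable_topology}"
  assumes f: "\<And>b. b \<in> Basis \<Longrightarrow> integrable lborel (f b)"
  shows "integrable lborel (\<lambda>x::'a. \<Prod>b\<in>Basis. f b (x \<bullet> b))"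
    and "(LINT x|lborel. (\<Prod>b\<in>Basis. f b (x \<bullet> b))) = (\<Prod>b\<in>Basis. (LINT t|lborel. f b t))"
proof -
  interpret product_sigma_finite "\<lambda>_::'a. lborel :: real measure" ..
  have [measurable]: "f b \<in> borel_measurable borel" if "b \<in> Basis" for b using f[OF that] by auto
  have eq: "(lborel :: 'a measure) = distr (\<Pi>\<^sub>M b\<in>Basis. lborel) borel (\<lambda>g. \<Sum>b\<in>Basis. g b *\<^sub>R b)"
    unfolding lborel_eq_real by (rule lborel_def)
  have [measurable]: "(\<lambda>g. \<Sum>b\<in>Basis. g b *\<^sub>R b) \<in> (\<Pi>\<^sub>M b\<in>(Basis::'a set). lborel) \<rightarrow>\<^sub>M borel"
    by measurable
  (* On the product space the coordinates of the represented vector are the components of g. *)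
  have cmp: "(\<Prod>b\<in>Basis. f b ((\<Sum>b\<in>Basis. g b *\<^sub>R b) \<bullet> b)) = (\<Prod>b\<in>Basis. f b (g b))" for g
    by (intro prod.cong) (auto simp: inner_sum_left_Basis)
  show "integrable lborel (\<lambda>x::'a. \<Prod>b\<in>Basis. f b (x \<bullet> b))"
    unfolding eq by (subst integrable_distr_eq) (auto simp: cmp intro!: product_integrable_prod f)
  show "(LINT x|lborel. (\<Prod>b\<in>Basis. f b (x \<bullet> b))) = (\<Prod>b\<in>Basis. (LINT t|lborel. f b t))"
    unfolding eq by (subst integral_distr) (auto simp: cmp intro!: product_integral_prod f)
qed

definition gauss_weight :: "'a::euclidean_space \<Rightarrow> real" where
  "gauss_weight v = (\<Prod>b\<in>Basis. std_normal_density (v \<bullet> b))"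

lemma gauss_weight_nonneg: "0 \<le> gauss_weight v"
  unfolding gauss_weight_def by (intro prod_nonneg) (auto simp: normal_density_nonneg)

lemma gauss_weight_integral:
  "integrable lborel (gauss_weight :: 'a::euclidean_space \<Rightarrow> real)"
  "(LINT v|lborel. gauss_weight (v::'a)) = 1"
  unfolding gauss_weight_def
  by (intro lborel_prod_Basis(1), simp, subst lborel_prod_Basis(2), simp_all)

lemma gauss_weight_measurable [measurable]: "gauss_weight \<in> borel_measurable borel"
  using borel_measurable_integrable[OF gauss_weight_integral(1)] by simp

text \<open>
  The Gaussian density is, up to a constant, its own inverse Fourier transform. Both sides factor over the
  coordinates, and in one variable this is the characteristic function of the normal distribution.
\<close>

lemma gauss_weight_eq_fourier_integral:
  "complex_of_real (gauss_weight (v::'a::euclidean_space)) =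
     complex_of_real (1 / sqrt (2 * pi) ^ DIM('a)) *
     (LINT \<xi>|lborel. iexp (v \<bullet> \<xi>) * complex_of_real (gauss_weight \<xi>))"
proof -
  have int1: "integrable lborel (\<lambda>t. iexp (s * t) * complex_of_real (std_normal_density t))" for s :: real
    by (rule Bochner_Integration.integrable_bound[of _ "\<lambda>t. std_normal_density t"])
       (auto simp: norm_mult abs_of_nonneg[OF normal_density_nonneg])
  have one: "(LINT t|lborel. iexp (s * t) * complex_of_real (std_normal_density t))
      = complex_of_real (exp (- (s\<^sup>2) / 2))" for s :: real
  proof -
    have "complex_of_real (exp (- (s\<^sup>2) / 2)) = char std_normal_distribution s"
      by (simp add: char_std_normal_distribution)
    also have "\<dots> = (LINT t|lborel. std_normal_density t *\<^sub>R iexp (s * t))"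
      unfolding char_def by (subst integral_density) (auto simp: normal_density_nonneg)
    finally show ?thesis by (simp add: scaleR_conv_of_real mult.commute)
  qed
  have prod_eq: "iexp (v \<bullet> \<xi>) * complex_of_real (gauss_weight \<xi>)
     = (\<Prod>b\<in>Basis. iexp ((v \<bullet> b) * (\<xi> \<bullet> b)) * complex_of_real (std_normal_density (\<xi> \<bullet> b)))" for \<xi>
  proof -
    have "iexp (v \<bullet> \<xi>) = (\<Prod>b\<in>Basis. iexp ((v \<bullet> b) * (\<xi> \<bullet> b)))"
      by (subst euclidean_inner) (simp add: sum_distrib_left exp_sum)
    then show ?thesis by (simp add: gauss_weight_def prod.distrib)
  qed
  have "(LINT \<xi>|lborel. iexp (v \<bullet> \<xi>) * complex_of_real (gauss_weight \<xi>))
     = (\<Prod>b\<in>Basis. complex_of_real (exp (- ((v \<bullet> b)\<^sup>2) / 2)))"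
    unfolding prod_eq
    by (subst lborel_prod_Basis(2)[OF int1]) (simp only: one)
  also have "\<dots> = (\<Prod>b\<in>Basis. complex_of_real (sqrt (2 * pi) * std_normal_density (v \<bullet> b)))"
    by (intro prod.cong) (auto simp: normal_density_def)
  also have "\<dots> = complex_of_real (sqrt (2 * pi) ^ DIM('a) * gauss_weight v)"
    by (simp add: gauss_weight_def prod.distrib)
  finally show ?thesis by simp
qed

text \<open>
  Inserting the Fourier representation of the Gaussian and exchanging the integrals turns the average
  into an integral of \<open>fourier h (\<xi> / c)\<close> against an integrable weight.
\<close>

lemma dilation_average_gauss_eq_0:
  fixes h :: "'a::euclidean_space \<Rightarrow> real"
  assumes h: "integrable lborel h" and four: "\<And>\<xi>. fourier h \<xi> = 0" and c: "0 < c"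
  shows "dilation_average gauss_weight h c x = 0"
proof -
  have [measurable]: "h \<in> borel_measurable borel" using h by auto
  define f where "f z \<xi> = complex_of_real (h (x - c *\<^sub>R z)) * (iexp (z \<bullet> \<xi>) * complex_of_real (gauss_weight \<xi>))" for z \<xi> :: 'a
  have hc: "integrable lborel (\<lambda>z. h (x - c *\<^sub>R z))"
    by (rule integrable_lborel_affine[OF h c])
  have nf: "norm (f z \<xi>) = \<bar>h (x - c *\<^sub>R z)\<bar> * gauss_weight \<xi>" for z \<xi>
    by (simp add: f_def norm_mult abs_of_nonneg[OF gauss_weight_nonneg])
  have f_meas [measurable]: "case_prod f \<in> borel_measurable (lborel \<Otimes>\<^sub>M lborel)"
    unfolding f_def by measurable
  have f_int: "integrable (lborel \<Otimes>\<^sub>M lborel) (case_prod f)"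
  proof (rule lborel_pair.Fubini_integrable)
    show "integrable lborel (\<lambda>z. LINT \<xi>|lborel. norm (case_prod f (z, \<xi>)))"
      using hc by (simp add: nf gauss_weight_integral)
    show "AE z in lborel. integrable lborel (\<lambda>\<xi>. case_prod f (z, \<xi>))"
    proof (rule AE_I2)
      fix z
      have "integrable lborel (\<lambda>\<xi>. \<bar>h (x - c *\<^sub>R z)\<bar> * gauss_weight \<xi>)"
        using gauss_weight_integral(1) by auto
      then show "integrable lborel (\<lambda>\<xi>. case_prod f (z, \<xi>))"
        by (rule Bochner_Integration.integrable_bound) (auto simp: nf abs_mult abs_of_nonneg[OF gauss_weight_nonneg])
    qed
  qed measurable
  have inner: "(LINT z|lborel. f z \<xi>) = 0" for \<xi>
  proof -
    define F where "F y = exp (- \<i> * complex_of_real (y \<bullet> ((1/c) *\<^sub>R \<xi>))) * complex_of_real (h y)" for y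
    have [measurable]: "F \<in> borel_measurable borel" unfolding F_def by measurable
    (* The frequency \<xi> / c turns y = x - c z into a fixed phase times the character at z. *)
    have phase: "- \<i> * complex_of_real ((x - c *\<^sub>R z) \<bullet> ((1/c) *\<^sub>R \<xi>))
        = - \<i> * complex_of_real (x \<bullet> \<xi> / c) + \<i> * complex_of_real (z \<bullet> \<xi>)" for z
      using c by (simp add: inner_diff_left diff_divide_distrib right_diff_distrib)
    have "F (x - c *\<^sub>R z) = exp (- \<i> * complex_of_real (x \<bullet> \<xi> / c)) * (iexp (z \<bullet> \<xi>) * complex_of_real (h (x - c *\<^sub>R z)))" for z
      unfolding F_def phase exp_add by simp
    then have "f z \<xi> = (exp (\<i> * complex_of_real (x \<bullet> \<xi> / c)) * complex_of_real (gauss_weight \<xi>)) * F (x - c *\<^sub>R z)" for z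
      by (simp add: f_def exp_minus field_simps)
    moreover have "(LINT z|lborel. F (x - c *\<^sub>R z)) = 0"
    proof -
      have "fourier h ((1/c) *\<^sub>R \<xi>) = (LINT y|lborel. F y)"
        by (simp only: fourier_def F_def)
      then show ?thesis
        using lborel_integral_affine[of F c x] c four[of "(1/c) *\<^sub>R \<xi>"] by simp
    qed
    ultimately show ?thesis by simp
  qed
  have "complex_of_real (dilation_average gauss_weight h c x)
     = (LINT z|lborel. complex_of_real (h (x - c *\<^sub>R z) * gauss_weight z))"
    unfolding dilation_average_def by (rule integral_complex_of_real[symmetric])
  also have "\<dots> = (LINT z|lborel. complex_of_real (1 / sqrt (2 * pi) ^ DIM('a)) * (LINT \<xi>|lborel. f z \<xi>))"
  proof (rule Bochner_Integration.integral_cong[OF refl])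
    fix z
    have "(LINT \<xi>|lborel. f z \<xi>)
      = complex_of_real (h (x - c *\<^sub>R z)) * (LINT \<xi>|lborel. iexp (z \<bullet> \<xi>) * complex_of_real (gauss_weight \<xi>))"
      unfolding f_def by (rule integral_mult_right_zero)
    then show "complex_of_real (h (x - c *\<^sub>R z) * gauss_weight z)
      = complex_of_real (1 / sqrt (2 * pi) ^ DIM('a)) * (LINT \<xi>|lborel. f z \<xi>)"
      by (subst of_real_mult, subst gauss_weight_eq_fourier_integral) (simp only: mult.left_commute)
  qed
  also have "\<dots> = complex_of_real (1 / sqrt (2 * pi) ^ DIM('a)) * (LINT z|lborel. (LINT \<xi>|lborel. f z \<xi>))"
    by simp
  also have "(LINT z|lborel. (LINT \<xi>|lborel. f z \<xi>)) = (LINT \<xi>|lborel. (LINT z|lborel. f z \<xi>))"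
    using lborel_pair.Fubini_integral[OF f_int] by simp
  also have "\<dots> = 0" by (simp add: inner)
  finally show ?thesis by simp
qed

lemma in_Lm_1_iff: "in_Lm 1 f \<longleftrightarrow> integrable lborel f"
  by (auto simp: in_Lm_iff integrable_iff_bounded)

text \<open>
  All Gaussian averages of the difference \<open>h\<close> vanish, while at scales tending to 0 they converge to \<open>h\<close> in \<open>L\<^sup>1\<close>.
\<close>

theorem fourier_inject_AE:
  fixes f g :: "'a::euclidean_space \<Rightarrow> real"
  assumes f: "integrable lborel f" and g: "integrable lborel g" and eq: "\<And>\<xi>. fourier f \<xi> = fourier g \<xi>"
  shows "AE x in lborel. f x = g x"
proof -
  define h where "h x = f x - g x" for x
  have [measurable]: "f \<in> borel_measurable borel" "g \<in> borel_measurable borel" using f g by auto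
  have h: "integrable lborel h" unfolding h_def using f g by simp
  have [measurable]: "h \<in> borel_measurable borel" using h by auto
  have int: "integrable lborel (\<lambda>x. exp (- \<i> * complex_of_real (x \<bullet> \<xi>)) * complex_of_real (k x))"
    if "integrable lborel k" for k :: "'a \<Rightarrow> real" and \<xi>
    using that by (rule Bochner_Integration.integrable_bound) (use that in \<open>auto simp: norm_mult\<close>)
  have four: "fourier h \<xi> = 0" for \<xi>
    using eq[of \<xi>] int[OF f, of \<xi>] int[OF g, of \<xi>] by (simp add: fourier_def h_def right_diff_distrib)
  have "(\<lambda>n. \<integral>\<^sup>+x. ennreal (\<bar>dilation_average gauss_weight h (1 / real (Suc n)) x - dilation_average gauss_weight h 0 x\<bar> powr 1) \<partial>lborel) \<longlonglongrightarrow> 0"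
    using h gauss_weight_integral(1) LIMSEQ_inverse_real_of_nat
    by (intro dilation_average_tendsto) (auto simp: in_Lm_1_iff inverse_eq_divide)
  moreover have "dilation_average gauss_weight h (1 / real (Suc n)) x = 0" for n x
    by (rule dilation_average_gauss_eq_0[OF h four]) simp
  moreover have "dilation_average gauss_weight h 0 x = h x" for x
    by (simp add: dilation_average_def gauss_weight_integral)
  ultimately have "(\<lambda>n::nat. \<integral>\<^sup>+x. ennreal \<bar>h x\<bar> \<partial>lborel) \<longlonglongrightarrow> 0"
    by simp
  then have "(\<integral>\<^sup>+x. ennreal \<bar>h x\<bar> \<partial>lborel) = 0"
    using LIMSEQ_unique tendsto_const by blast
  then have "AE x in lborel. ennreal \<bar>h x\<bar> = 0"
    by (subst (asm) nn_integral_0_iff_AE) auto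
  then show ?thesis by eventually_elim (simp add: h_def)
qed

section \<open>Convolution with self-similar kernels\<close>

text \<open>
  A dilation relation between transforms becomes one between the functions by injectivity of
  the Fourier transform. This is how self-similarity of the kernels is obtained from their
  transforms alone.
\<close>

lemma AE_dilated_kernel:
  fixes k K :: "'a::euclidean_space \<Rightarrow> real"
  assumes k: "integrable lborel k" and K: "integrable lborel K" and c: "0 < c"
    and four: "\<And>\<xi>. fourier k \<xi> = complex_of_real b * fourier K (c *\<^sub>R \<xi>)"
  shows "AE z in lborel. c ^ DIM('a) * k (c *\<^sub>R z) = b * K z"
proof (rule fourier_inject_AE)
  have [measurable]: "k \<in> borel_measurable borel" using k by auto
  have "integrable lborel (\<lambda>x. k (- x))"
    using integrable_lborel_affine[OF k zero_less_one, of 0] by simp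
  from integrable_lborel_affine[OF this c, of 0] have "integrable lborel (\<lambda>x. k (c *\<^sub>R x))" by simp
  then show "integrable lborel (\<lambda>z. c ^ DIM('a) * k (c *\<^sub>R z))" by simp
  show "integrable lborel (\<lambda>z. b * K z)" using K by simp
  fix \<xi>
  have shift: "fourier k \<eta> = complex_of_real (c ^ DIM('a)) * fourier (\<lambda>z. k (c *\<^sub>R z)) (c *\<^sub>R \<eta>)" for \<eta>
  proof -
    define F where "F y = exp (- \<i> * complex_of_real (y \<bullet> \<eta>)) * complex_of_real (k y)" for y
    have [measurable]: "F \<in> borel_measurable borel" unfolding F_def by measurable
    have "fourier k \<eta> = (LINT y|lborel. F y)"
      by (simp only: fourier_def F_def)
    also have "\<dots> = complex_of_real (c ^ DIM('a)) * (LINT z|lborel. F (0 - c *\<^sub>R z))"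
      using lborel_integral_affine[of F c 0] c by (simp add: scaleR_conv_of_real)
    also have "(LINT z|lborel. F (0 - c *\<^sub>R z)) = (LINT z|lborel. F (c *\<^sub>R z))"
      using lborel_integral_affine[of "\<lambda>z. F (c *\<^sub>R z)" 1 0] by simp
    finally show ?thesis by (simp add: F_def fourier_def)
  qed
  have "fourier (\<lambda>z. c ^ DIM('a) * k (c *\<^sub>R z)) \<xi> = complex_of_real (c ^ DIM('a)) * fourier (\<lambda>z. k (c *\<^sub>R z)) \<xi>"
    by (simp add: fourier_def mult.left_commute)
  also have "\<dots> = fourier k ((1 / c) *\<^sub>R \<xi>)" using shift[of "(1 / c) *\<^sub>R \<xi>"] c by simp
  also have "\<dots> = complex_of_real b * fourier K \<xi>" using four[of "(1 / c) *\<^sub>R \<xi>"] c by simp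
  also have "\<dots> = fourier (\<lambda>z. b * K z) \<xi>"
    by (simp add: fourier_def mult.left_commute)
  finally show "fourier (\<lambda>z. c ^ DIM('a) * k (c *\<^sub>R z)) \<xi> = fourier (\<lambda>z. b * K z) \<xi>" .
qed

text \<open>
  Substitute \<open>y = x - c z\<close>. The null set where \<open>k(c z)\<close> and \<open>K z\<close> are not proportional lies in the variable
  \<open>z\<close> of integration, so the identities hold for every \<open>x\<close>, including those where the integrals diverge.
\<close>

lemma dilated_kernel_convolution:
  fixes k K g :: "'a::euclidean_space \<Rightarrow> real"
  assumes k: "integrable lborel k" and K: "integrable lborel K" and c: "0 < c"
    and four: "\<And>\<xi>. fourier k \<xi> = complex_of_real b * fourier K (c *\<^sub>R \<xi>)"
    and [measurable]: "g \<in> borel_measurable borel"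
  shows "(LINT y|lborel. g y * k (x - y)) = b * (LINT z|lborel. g (x - c *\<^sub>R z) * K z)"
    and "(\<integral>\<^sup>+y. ennreal \<bar>g y * k (x - y)\<bar> \<partial>lborel)
       = ennreal \<bar>b\<bar> * (\<integral>\<^sup>+z. ennreal \<bar>g (x - c *\<^sub>R z) * K z\<bar> \<partial>lborel)"
proof -
  have [measurable]: "k \<in> borel_measurable borel" "K \<in> borel_measurable borel" using k K by auto
  note AE = AE_dilated_kernel[OF k K c four]
  have "(LINT y|lborel. g y * k (x - y)) = (LINT z|lborel. c ^ DIM('a) * (g (x - c *\<^sub>R z) * k (c *\<^sub>R z)))"
    using lborel_integral_affine[of "\<lambda>y. g y * k (x - y)" c x] c by simp
  also have "\<dots> = (LINT z|lborel. b * (g (x - c *\<^sub>R z) * K z))"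
  proof (rule integral_cong_AE)
    show "AE z in lborel. c ^ DIM('a) * (g (x - c *\<^sub>R z) * k (c *\<^sub>R z)) = b * (g (x - c *\<^sub>R z) * K z)"
      using AE by eventually_elim (simp add: mult.left_commute)
  qed measurable
  finally show "(LINT y|lborel. g y * k (x - y)) = b * (LINT z|lborel. g (x - c *\<^sub>R z) * K z)" by simp
  have "(\<integral>\<^sup>+y. ennreal \<bar>g y * k (x - y)\<bar> \<partial>lborel)
      = ennreal (c ^ DIM('a)) * (\<integral>\<^sup>+z. ennreal \<bar>g (x - c *\<^sub>R z) * k (c *\<^sub>R z)\<bar> \<partial>lborel)"
    using nn_integral_lborel_affine[of "\<lambda>y. ennreal \<bar>g y * k (x - y)\<bar>" c x] c by simp
  also have "\<dots> = (\<integral>\<^sup>+z. ennreal (c ^ DIM('a)) * ennreal \<bar>g (x - c *\<^sub>R z) * k (c *\<^sub>R z)\<bar> \<partial>lborel)"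
    by (rule nn_integral_cmult[symmetric]) measurable
  also have "\<dots> = (\<integral>\<^sup>+z. ennreal \<bar>b\<bar> * ennreal \<bar>g (x - c *\<^sub>R z) * K z\<bar> \<partial>lborel)"
  proof (rule nn_integral_cong_AE, use AE in eventually_elim)
    case (elim z)
    have "c ^ DIM('a) * \<bar>k (c *\<^sub>R z)\<bar> = \<bar>b\<bar> * \<bar>K z\<bar>"
      using elim c by (metis abs_mult abs_of_pos zero_less_power)
    then have "c ^ DIM('a) * \<bar>g (x - c *\<^sub>R z) * k (c *\<^sub>R z)\<bar> = \<bar>b\<bar> * \<bar>g (x - c *\<^sub>R z) * K z\<bar>"
      by (simp add: abs_mult mult.left_commute)
    then show ?case using c by (simp add: ennreal_mult[symmetric] del: abs_mult)
  qed
  also have "\<dots> = ennreal \<bar>b\<bar> * (\<integral>\<^sup>+z. ennreal \<bar>g (x - c *\<^sub>R z) * K z\<bar> \<partial>lborel)"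
    by (rule nn_integral_cmult) measurable
  finally show "(\<integral>\<^sup>+y. ennreal \<bar>g y * k (x - y)\<bar> \<partial>lborel)
       = ennreal \<bar>b\<bar> * (\<integral>\<^sup>+z. ennreal \<bar>g (x - c *\<^sub>R z) * K z\<bar> \<partial>lborel)" .
qed

section \<open>Interpolation between \<open>L\<^sup>1\<close> and \<open>L\<^sup>p\<close>\<close>

text \<open>
  Below the threshold \<open>R\<close> the exponent \<open>q\<close> is compared with 1, above it with \<open>p\<close>.
\<close>

lemma powr_interpolation_le:
  fixes x R p q :: real
  assumes q: "1 \<le> q" "q < p" and R: "0 < R"
  shows "\<bar>x\<bar> powr q \<le> R powr (q - 1) * \<bar>x\<bar> + R powr (q - p) * \<bar>x\<bar> powr p"
proof (cases "\<bar>x\<bar> \<le> R")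
  case True
  have "\<bar>x\<bar> powr q = \<bar>x\<bar> powr (q - 1) * \<bar>x\<bar>" by (cases "x = 0") (auto simp: powr_diff)
  also have "\<dots> \<le> R powr (q - 1) * \<bar>x\<bar>"
    using q True by (intro mult_right_mono powr_mono2) auto
  finally show ?thesis by (simp add: add_increasing2)
next
  case False
  have "\<bar>x\<bar> powr q = \<bar>x\<bar> powr (q - p) * \<bar>x\<bar> powr p" using False R by (simp add: powr_diff)
  also have "\<dots> \<le> R powr (q - p) * \<bar>x\<bar> powr p"
    using q False R by (intro mult_right_mono powr_mono2') auto
  finally show ?thesis using R by (simp add: add_increasing)
qed

lemma nn_integral_powr_interpolation_le:
  fixes d :: "'b \<Rightarrow> real"
  assumes [measurable]: "d \<in> borel_measurable M" and q: "1 \<le> q" "q < p" and R: "0 < R"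
  shows "(\<integral>\<^sup>+x. ennreal (\<bar>d x\<bar> powr q) \<partial>M)
     \<le> ennreal (R powr (q - 1)) * (\<integral>\<^sup>+x. ennreal \<bar>d x\<bar> \<partial>M)
       + ennreal (R powr (q - p)) * (\<integral>\<^sup>+x. ennreal (\<bar>d x\<bar> powr p) \<partial>M)"
proof -
  have "(\<integral>\<^sup>+x. ennreal (\<bar>d x\<bar> powr q) \<partial>M)
     \<le> (\<integral>\<^sup>+x. ennreal (R powr (q - 1)) * ennreal \<bar>d x\<bar>
            + ennreal (R powr (q - p)) * ennreal (\<bar>d x\<bar> powr p) \<partial>M)"
    using powr_interpolation_le[OF q R]
    by (intro nn_integral_mono) (auto simp: ennreal_mult'[symmetric] ennreal_plus[symmetric] simp del: ennreal_plus intro!: ennreal_leI)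
  also have "\<dots> = ennreal (R powr (q - 1)) * (\<integral>\<^sup>+x. ennreal \<bar>d x\<bar> \<partial>M)
       + ennreal (R powr (q - p)) * (\<integral>\<^sup>+x. ennreal (\<bar>d x\<bar> powr p) \<partial>M)"
    by (subst nn_integral_add) (auto simp: nn_integral_cmult)
  finally show ?thesis .
qed

text \<open>
  A large threshold makes the \<open>L\<^sup>p\<close> contribution small uniformly in \<open>n\<close>; for this fixed threshold the
  \<open>L\<^sup>1\<close> contribution tends to 0.
\<close>

lemma interpolation_tendsto_0:
  fixes d :: "nat \<Rightarrow> 'b \<Rightarrow> real"
  assumes [measurable]: "\<And>n. d n \<in> borel_measurable M" and q: "1 \<le> q" "q < p"
    and L1: "(\<lambda>n. \<integral>\<^sup>+x. ennreal \<bar>d n x\<bar> \<partial>M) \<longlonglongrightarrow> 0"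
    and Lp: "\<forall>\<^sub>F n in sequentially. (\<integral>\<^sup>+x. ennreal (\<bar>d n x\<bar> powr p) \<partial>M) \<le> ennreal C" and C: "0 \<le> C"
  shows "(\<lambda>n. \<integral>\<^sup>+x. ennreal (\<bar>d n x\<bar> powr q) \<partial>M) \<longlonglongrightarrow> 0"
proof (rule ennreal_tendsto_0I)
  fix e :: real assume e: "0 < e"
  (* The threshold for which the coefficient of the p-th power integral is e / (2 * C + 2). *)
  define R where "R = (e / (2 * C + 2)) powr (1 / (q - p))"
  have R: "0 < R" using e C by (auto simp: R_def)
  have Rp: "R powr (q - p) = e / (2 * C + 2)" using e C q by (simp add: R_def powr_powr)
  have "(\<lambda>n. ennreal (R powr (q - 1)) * (\<integral>\<^sup>+x. ennreal \<bar>d n x\<bar> \<partial>M)) \<longlonglongrightarrow> ennreal (R powr (q - 1)) * 0"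
    by (intro ennreal_tendsto_cmult L1) simp
  then have "\<forall>\<^sub>F n in sequentially. ennreal (R powr (q - 1)) * (\<integral>\<^sup>+x. ennreal \<bar>d n x\<bar> \<partial>M) < ennreal (e/2)"
    using e by (intro order_tendstoD) auto
  then show "\<forall>\<^sub>F n in sequentially. (\<integral>\<^sup>+x. ennreal (\<bar>d n x\<bar> powr q) \<partial>M) \<le> ennreal e"
    using Lp
  proof eventually_elim
    case (elim n)
    have "(\<integral>\<^sup>+x. ennreal (\<bar>d n x\<bar> powr q) \<partial>M) \<le> ennreal (e/2) + ennreal (e / (2 * C + 2)) * ennreal C"
      using elim Rp
      by (intro order_trans[OF nn_integral_powr_interpolation_le[OF _ q R]] add_mono mult_mono) auto
    also have "\<dots> = ennreal (e / 2 + e / (2 * C + 2) * C)"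
      using e C by (simp add: ennreal_plus ennreal_mult[symmetric])
    also have "\<dots> \<le> ennreal e"
      using e C by (intro ennreal_leI) (simp add: field_simps)
    finally show ?case .
  qed
qed

text \<open>
  Fatou's lemma along a subsequence that converges almost everywhere.
\<close>

lemma powr_integral_le_of_L1_limit:
  fixes d :: "nat \<Rightarrow> 'b \<Rightarrow> real"
  assumes [measurable]: "\<And>n. d n \<in> borel_measurable M" "d0 \<in> borel_measurable M"
    and L1: "(\<lambda>n. \<integral>\<^sup>+x. ennreal \<bar>d n x - d0 x\<bar> \<partial>M) \<longlonglongrightarrow> 0"
    and fin: "\<And>n. (\<integral>\<^sup>+x. ennreal \<bar>d n x - d0 x\<bar> \<partial>M) < \<infinity>"
    and Lp: "\<And>n. (\<integral>\<^sup>+x. ennreal (\<bar>d n x\<bar> powr p) \<partial>M) \<le> C" and p: "0 < p"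
  shows "(\<integral>\<^sup>+x. ennreal (\<bar>d0 x\<bar> powr p) \<partial>M) \<le> C"
proof -
  have int: "integrable M (\<lambda>x. d n x - d0 x)" for n
    using fin[of n] by (simp add: integrable_iff_bounded)
  have "(\<lambda>n. ennreal (LINT x|M. norm (d n x - d0 x))) \<longlonglongrightarrow> 0"
    using L1 int by (simp add: nn_integral_eq_integral)
  then have "(\<lambda>n. LINT x|M. norm (d n x - d0 x)) \<longlonglongrightarrow> 0"
    by (subst (asm) ennreal_tendsto_0_iff) auto
  from tendsto_L1_AE_subseq[OF int this]
  obtain r where r: "strict_mono r" "AE x in M. (\<lambda>n. d (r n) x - d0 x) \<longlonglongrightarrow> 0" by blast
  have "AE x in M. liminf (\<lambda>n. ennreal (\<bar>d (r n) x\<bar> powr p)) = ennreal (\<bar>d0 x\<bar> powr p)"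
    using r(2)
  proof eventually_elim
    case (elim x)
    then have "(\<lambda>n. \<bar>d (r n) x\<bar>) \<longlonglongrightarrow> \<bar>d0 x\<bar>" by (intro tendsto_rabs) (simp add: LIM_zero_iff)
    then have "(\<lambda>n. \<bar>d (r n) x\<bar> powr p) \<longlonglongrightarrow> \<bar>d0 x\<bar> powr p"
      using p by (intro tendsto_powr2) auto
    then have "(\<lambda>n. ennreal (\<bar>d (r n) x\<bar> powr p)) \<longlonglongrightarrow> ennreal (\<bar>d0 x\<bar> powr p)" by (rule tendsto_ennrealI)
    then show ?case by (intro lim_imp_Liminf) auto
  qed
  then have "(\<integral>\<^sup>+x. ennreal (\<bar>d0 x\<bar> powr p) \<partial>M) = (\<integral>\<^sup>+x. liminf (\<lambda>n. ennreal (\<bar>d (r n) x\<bar> powr p)) \<partial>M)"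
    by (intro nn_integral_cong_AE) (rule AE_mp, assumption, simp)
  also have "\<dots> \<le> liminf (\<lambda>n. \<integral>\<^sup>+x. ennreal (\<bar>d (r n) x\<bar> powr p) \<partial>M)"
    by (rule nn_integral_liminf) measurable
  also have "\<dots> \<le> C"
    using Lp by (intro Liminf_le) auto
  finally show ?thesis .
qed

section \<open>Duhamel integrals\<close>

lemma nn_integral_reflect:
  fixes F :: "real \<Rightarrow> ennreal"
  assumes "F \<in> borel_measurable borel"
  shows "(\<integral>\<^sup>+s. F (t - s) \<partial>lborel) = (\<integral>\<^sup>+s. F s \<partial>lborel)"
  using nn_integral_lborel_affine[OF assms, of 1 t] by simp

text \<open>
  A divergent integral has the value 0, so the bound also covers functions that are not integrable.
\<close>

lemma abs_lebesgue_integral_le_nn_integral: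
  fixes f :: "'b \<Rightarrow> real"
  shows "ennreal \<bar>LINT x|M. f x\<bar> \<le> (\<integral>\<^sup>+x. ennreal \<bar>f x\<bar> \<partial>M)"
  using integral_norm_bound_ennreal[of M f] by (cases "integrable M f") (auto simp: not_integrable_integral_eq)

lemma iterated_integral_diff_le:
  fixes G H :: "'b \<Rightarrow> 'c \<Rightarrow> real"
  assumes "pair_sigma_finite M N"
    and [measurable]: "case_prod G \<in> borel_measurable (M \<Otimes>\<^sub>M N)" "case_prod H \<in> borel_measurable (M \<Otimes>\<^sub>M N)"
    and G: "(\<integral>\<^sup>+s. (\<integral>\<^sup>+z. ennreal \<bar>G s z\<bar> \<partial>N) \<partial>M) < \<infinity>"
    and H: "(\<integral>\<^sup>+s. (\<integral>\<^sup>+z. ennreal \<bar>H s z\<bar> \<partial>N) \<partial>M) < \<infinity>"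
  shows "ennreal \<bar>(LINT s|M. (LINT z|N. G s z)) - (LINT s|M. (LINT z|N. H s z))\<bar>
     \<le> (\<integral>\<^sup>+s. (\<integral>\<^sup>+z. ennreal \<bar>G s z - H s z\<bar> \<partial>N) \<partial>M)"
proof -
  interpret pair_sigma_finite M N by fact
  have int: "integrable (M \<Otimes>\<^sub>M N) (case_prod F)"
    if F [measurable]: "case_prod F \<in> borel_measurable (M \<Otimes>\<^sub>M N)"
      and fin: "(\<integral>\<^sup>+s. (\<integral>\<^sup>+z. ennreal \<bar>F s z\<bar> \<partial>N) \<partial>M) < \<infinity>" for F :: "'b \<Rightarrow> 'c \<Rightarrow> real"
    using fin M2.nn_integral_fst[of "\<lambda>w. ennreal (norm (case_prod F w))" M]
    by (simp add: integrable_iff_bounded)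
  note iG = int[OF assms(2) G] and iH = int[OF assms(3) H]
  have "(LINT s|M. (LINT z|N. G s z)) - (LINT s|M. (LINT z|N. H s z))
     = (LINT w|(M \<Otimes>\<^sub>M N). case_prod G w - case_prod H w)"
    using integral_fst'[OF iG] integral_fst'[OF iH]
    by (subst Bochner_Integration.integral_diff[OF iG iH]) simp
  then have "ennreal \<bar>(LINT s|M. (LINT z|N. G s z)) - (LINT s|M. (LINT z|N. H s z))\<bar>
     \<le> (\<integral>\<^sup>+w. ennreal \<bar>case_prod G w - case_prod H w\<bar> \<partial>(M \<Otimes>\<^sub>M N))"
    using abs_lebesgue_integral_le_nn_integral by metis
  also have "\<dots> = (\<integral>\<^sup>+s. (\<integral>\<^sup>+z. ennreal \<bar>G s z - H s z\<bar> \<partial>N) \<partial>M)"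
    using M2.nn_integral_fst[of "\<lambda>w. ennreal \<bar>case_prod G w - case_prod H w\<bar>" M] by simp
  finally show ?thesis .
qed

text \<open>
  The integral \<open>\<integral> k(t - s) (F(\<cdot>,s) averaged over its dilates by l(t - s)) ds\<close>. With a weight \<open>k\<close> supported on positive
  times and a source \<open>F\<close> vanishing at negative times this is a Duhamel integral over \<open>(0,t)\<close>, but
  extending all functions to the whole line makes every dependence on \<open>t\<close> a dependence on a translation.
\<close>

definition duhamel_average ::
  "(real \<Rightarrow> real) \<Rightarrow> (real \<Rightarrow> real) \<Rightarrow> ('a::euclidean_space \<Rightarrow> real) \<Rightarrow> ('a \<times> real \<Rightarrow> real) \<Rightarrow> real \<Rightarrow> 'a \<Rightarrow> real" where
  "duhamel_average k l K F t x =
     (LINT s|lborel. (LINT z|lborel. k (t - s) * (F (x - l (t - s) *\<^sub>R z, s) * K z)))"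

locale duhamel_data =
  fixes k l :: "real \<Rightarrow> real" and K :: "'a::euclidean_space \<Rightarrow> real" and F :: "'a \<times> real \<Rightarrow> real" and B :: real
  assumes k: "integrable lborel k" and l: "continuous_on UNIV l" and K: "integrable lborel K"
    and F_measurable: "F \<in> borel_measurable borel" and B: "0 \<le> B"
    and F_bound: "AE s in lborel. (\<integral>\<^sup>+x. ennreal \<bar>F (x, s)\<bar> \<partial>lborel) \<le> ennreal B"
begin

lemma k_meas [measurable]: "k \<in> borel_measurable borel" using k by auto
lemma K_meas [measurable]: "K \<in> borel_measurable borel" using K by auto
lemma l_meas [measurable]: "l \<in> borel_measurable borel"
  using l by (rule borel_measurable_continuous_onI)
lemma F_meas [measurable]: "F \<in> borel_measurable borel" by (rule F_measurable)

abbreviation W :: "real \<Rightarrow> 'a \<Rightarrow> real \<Rightarrow> 'a \<Rightarrow> real" where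
  "W t x s z \<equiv> k (t - s) * (F (x - l (t - s) *\<^sub>R z, s) * K z)"

definition k_mass :: ennreal where "k_mass = (\<integral>\<^sup>+s. ennreal \<bar>k s\<bar> \<partial>lborel)"
definition K_mass :: ennreal where "K_mass = (\<integral>\<^sup>+z. ennreal \<bar>K z\<bar> \<partial>lborel)"

lemma mass_finite: "k_mass < \<infinity>" "K_mass < \<infinity>"
  using k K by (auto simp: k_mass_def K_mass_def integrable_iff_bounded)

lemma F_translate:
  "(\<integral>\<^sup>+x. ennreal \<bar>F (x - h, s)\<bar> \<partial>lborel) = (\<integral>\<^sup>+x. ennreal \<bar>F (x, s)\<bar> \<partial>lborel)"
  by (rule nn_integral_lborel_translate[of "\<lambda>x. ennreal \<bar>F (x, s)\<bar>"]) measurable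

text \<open>
  By Tonelli's theorem the integral over \<open>x\<close> can be done first, and it does not see the shift of \<open>F\<close>.
\<close>

lemma W_total_mass:
  "(\<integral>\<^sup>+x. (\<integral>\<^sup>+s. (\<integral>\<^sup>+z. ennreal \<bar>W t x s z\<bar> \<partial>lborel) \<partial>lborel) \<partial>lborel) \<le> k_mass * (K_mass * ennreal B)"
proof -
  have "(\<integral>\<^sup>+x. (\<integral>\<^sup>+s. (\<integral>\<^sup>+z. ennreal \<bar>W t x s z\<bar> \<partial>lborel) \<partial>lborel) \<partial>(lborel :: 'a measure))
     = (\<integral>\<^sup>+s. (\<integral>\<^sup>+x. (\<integral>\<^sup>+z. ennreal \<bar>W t x s z\<bar> \<partial>lborel) \<partial>lborel) \<partial>lborel)"
    by (rule lborel_pair.Fubini'[symmetric]) measurable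
  also have "\<dots> = (\<integral>\<^sup>+s. (\<integral>\<^sup>+z. (\<integral>\<^sup>+x. ennreal \<bar>W t x s z\<bar> \<partial>lborel) \<partial>lborel) \<partial>lborel)"
    by (intro nn_integral_cong lborel_pair.Fubini'[symmetric]) measurable
  also have "\<dots> \<le> (\<integral>\<^sup>+s. ennreal \<bar>k (t - s)\<bar> * (K_mass * ennreal B) \<partial>lborel)"
  proof (rule nn_integral_mono_AE, use F_bound in eventually_elim)
    case (elim s)
    have "(\<integral>\<^sup>+x. ennreal \<bar>W t x s z\<bar> \<partial>lborel)
       = (\<integral>\<^sup>+x. ennreal (\<bar>k (t - s)\<bar> * \<bar>K z\<bar>) * ennreal \<bar>F (x - l (t - s) *\<^sub>R z, s)\<bar> \<partial>lborel)" for z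
      by (intro nn_integral_cong) (simp add: abs_mult ennreal_mult[symmetric] mult_ac)
    also have "\<dots>z = ennreal (\<bar>k (t - s)\<bar> * \<bar>K z\<bar>) * (\<integral>\<^sup>+x. ennreal \<bar>F (x, s)\<bar> \<partial>lborel)" for z
      by (subst nn_integral_cmult) (auto simp: F_translate)
    finally have "(\<integral>\<^sup>+z. (\<integral>\<^sup>+x. ennreal \<bar>W t x s z\<bar> \<partial>lborel) \<partial>lborel)
       \<le> (\<integral>\<^sup>+z. ennreal \<bar>k (t - s)\<bar> * (ennreal \<bar>K z\<bar> * ennreal B) \<partial>lborel)"
      using elim by (intro nn_integral_mono) (auto simp: ennreal_mult mult.assoc intro!: mult_left_mono)
    also have "\<dots> = ennreal \<bar>k (t - s)\<bar> * (K_mass * ennreal B)"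
      by (simp add: nn_integral_cmult nn_integral_multc K_mass_def)
    finally show ?case .
  qed
  also have "\<dots> = k_mass * (K_mass * ennreal B)"
    using nn_integral_reflect[of "\<lambda>s. ennreal \<bar>k s\<bar>" t]
    by (simp add: nn_integral_multc k_mass_def)
  finally show ?thesis .
qed

lemma duhamel_average_measurable [measurable]: "duhamel_average k l K F t \<in> borel_measurable borel"
  unfolding duhamel_average_def by measurable

lemma AE_W_finite:
  "AE x in lborel. (\<integral>\<^sup>+s. (\<integral>\<^sup>+z. ennreal \<bar>W t x s z\<bar> \<partial>lborel) \<partial>lborel) < \<infinity>"
proof -
  have "AE x in lborel. (\<integral>\<^sup>+s. (\<integral>\<^sup>+z. ennreal \<bar>W t x s z\<bar> \<partial>lborel) \<partial>lborel) \<noteq> \<infinity>"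
    using order.strict_trans1[OF W_total_mass, of \<infinity> t] mass_finite
    by (intro nn_integral_PInf_AE) (auto simp: ennreal_mult_less_top)
  then show ?thesis by (auto simp: less_top)
qed

lemma duhamel_average_L1:
  "(\<integral>\<^sup>+x. ennreal \<bar>duhamel_average k l K F t x\<bar> \<partial>lborel) \<le> k_mass * (K_mass * ennreal B)"
proof (rule order_trans[OF nn_integral_mono W_total_mass])
  fix x
  show "ennreal \<bar>duhamel_average k l K F t x\<bar> \<le> (\<integral>\<^sup>+s. (\<integral>\<^sup>+z. ennreal \<bar>W t x s z\<bar> \<partial>lborel) \<partial>lborel)"
    unfolding duhamel_average_def
    by (rule order_trans[OF abs_lebesgue_integral_le_nn_integral])
       (intro nn_integral_mono abs_lebesgue_integral_le_nn_integral)
qed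

text \<open>
  The integrands at times \<open>t\<close> and \<open>t0\<close> differ in the weight and in the shift. Changing the weight first costs the
  \<open>L\<^sup>1\<close> modulus of \<open>k\<close>, since \<open>F\<close> is bounded in \<open>L\<^sup>1\<close>; changing the shift then costs the modulus of the
  slices of \<open>F\<close>.
\<close>

lemma duhamel_average_diff_bound:
  "(\<integral>\<^sup>+x. ennreal \<bar>duhamel_average k l K F t x - duhamel_average k l K F t0 x\<bar> \<partial>lborel)
    \<le> K_mass * ennreal B * translation_modulus k (t0 - t)
      + (\<integral>\<^sup>+s. ennreal \<bar>k (t0 - s)\<bar> * (\<integral>\<^sup>+z. ennreal \<bar>K z\<bar> *
            translation_modulus (\<lambda>x. F (x, s)) ((l (t - s) - l (t0 - s)) *\<^sub>R z) \<partial>lborel) \<partial>lborel)"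
proof -
  define m where "m s z = translation_modulus (\<lambda>x. F (x, s)) ((l (t - s) - l (t0 - s)) *\<^sub>R z)" for s z
  have m_meas [measurable]: "case_prod m \<in> borel_measurable (lborel \<Otimes>\<^sub>M lborel)"
    unfolding m_def translation_modulus_def by measurable
  have "(\<integral>\<^sup>+x. ennreal \<bar>duhamel_average k l K F t x - duhamel_average k l K F t0 x\<bar> \<partial>lborel)
    \<le> (\<integral>\<^sup>+x. (\<integral>\<^sup>+s. (\<integral>\<^sup>+z. ennreal \<bar>W t x s z - W t0 x s z\<bar> \<partial>lborel) \<partial>lborel) \<partial>(lborel :: 'a measure))"
  proof (rule nn_integral_mono_AE, use AE_W_finite[of t] AE_W_finite[of t0] in eventually_elim)
    case (elim x)
    then show ?case
      unfolding duhamel_average_def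
      by (intro iterated_integral_diff_le) (auto intro!: lborel_pair.pair_sigma_finite_axioms)
  qed
  also have "\<dots> = (\<integral>\<^sup>+s. (\<integral>\<^sup>+x. (\<integral>\<^sup>+z. ennreal \<bar>W t x s z - W t0 x s z\<bar> \<partial>lborel) \<partial>lborel) \<partial>lborel)"
    by (rule lborel_pair.Fubini'[symmetric]) measurable
  also have "\<dots> = (\<integral>\<^sup>+s. (\<integral>\<^sup>+z. (\<integral>\<^sup>+x. ennreal \<bar>W t x s z - W t0 x s z\<bar> \<partial>lborel) \<partial>lborel) \<partial>lborel)"
    by (intro nn_integral_cong lborel_pair.Fubini'[symmetric]) measurable
  also have "\<dots> \<le> (\<integral>\<^sup>+s. K_mass * ennreal B * ennreal \<bar>k (t - s) - k (t0 - s)\<bar>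
       + ennreal \<bar>k (t0 - s)\<bar> * (\<integral>\<^sup>+z. ennreal \<bar>K z\<bar> * m s z \<partial>lborel) \<partial>lborel)"
  proof (rule nn_integral_mono_AE, use F_bound in eventually_elim)
    case (elim s)
    have "(\<integral>\<^sup>+x. ennreal \<bar>W t x s z - W t0 x s z\<bar> \<partial>lborel)
       \<le> ennreal \<bar>K z\<bar> * (ennreal B * ennreal \<bar>k (t - s) - k (t0 - s)\<bar>) + ennreal \<bar>k (t0 - s)\<bar> * (ennreal \<bar>K z\<bar> * m s z)" for z
    proof -
      define a b where "a x = F (x - l (t - s) *\<^sub>R z, s)" and "b x = F (x - l (t0 - s) *\<^sub>R z, s)" for x
      have [measurable]: "a \<in> borel_measurable borel" "b \<in> borel_measurable borel" unfolding a_def b_def by measurable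
      have "\<bar>W t x s z - W t0 x s z\<bar> \<le> \<bar>K z\<bar> * \<bar>k (t - s) - k (t0 - s)\<bar> * \<bar>a x\<bar> + \<bar>k (t0 - s)\<bar> * \<bar>K z\<bar> * \<bar>a x - b x\<bar>" for x
      proof -
        have "W t x s z - W t0 x s z = K z * (k (t - s) - k (t0 - s)) * a x + k (t0 - s) * K z * (a x - b x)"
          by (simp add: a_def b_def algebra_simps)
        then show ?thesis by (metis abs_mult abs_triangle_ineq)
      qed
      then have "(\<integral>\<^sup>+x. ennreal \<bar>W t x s z - W t0 x s z\<bar> \<partial>lborel)
        \<le> (\<integral>\<^sup>+x. ennreal (\<bar>K z\<bar> * \<bar>k (t - s) - k (t0 - s)\<bar>) * ennreal \<bar>a x\<bar>
              + ennreal (\<bar>k (t0 - s)\<bar> * \<bar>K z\<bar>) * ennreal \<bar>a x - b x\<bar> \<partial>lborel)"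
        by (intro nn_integral_mono) (simp add: ennreal_mult[symmetric] ennreal_plus[symmetric] ennreal_leI del: ennreal_plus)
      also have "\<dots> = ennreal (\<bar>K z\<bar> * \<bar>k (t - s) - k (t0 - s)\<bar>) * (\<integral>\<^sup>+x. ennreal \<bar>a x\<bar> \<partial>lborel)
              + ennreal (\<bar>k (t0 - s)\<bar> * \<bar>K z\<bar>) * (\<integral>\<^sup>+x. ennreal \<bar>a x - b x\<bar> \<partial>lborel)"
        by (subst nn_integral_add) (auto simp: nn_integral_cmult)
      also have "(\<integral>\<^sup>+x. ennreal \<bar>a x\<bar> \<partial>lborel) = (\<integral>\<^sup>+x. ennreal \<bar>F (x, s)\<bar> \<partial>lborel)"
        unfolding a_def by (rule F_translate)
      also have "(\<integral>\<^sup>+x. ennreal \<bar>a x - b x\<bar> \<partial>lborel) = m s z"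
        unfolding a_def b_def m_def using nn_integral_abs_diff_translates[of "\<lambda>x. F (x, s)"]
        by (simp add: scaleR_left_diff_distrib)
      finally have "(\<integral>\<^sup>+x. ennreal \<bar>W t x s z - W t0 x s z\<bar> \<partial>lborel)
        \<le> ennreal (\<bar>K z\<bar> * \<bar>k (t - s) - k (t0 - s)\<bar>) * (\<integral>\<^sup>+x. ennreal \<bar>F (x, s)\<bar> \<partial>lborel)
          + ennreal (\<bar>k (t0 - s)\<bar> * \<bar>K z\<bar>) * m s z" .
      also have "\<dots> \<le> ennreal (\<bar>K z\<bar> * \<bar>k (t - s) - k (t0 - s)\<bar>) * ennreal B
          + ennreal (\<bar>k (t0 - s)\<bar> * \<bar>K z\<bar>) * m s z"
        using elim by (intro add_mono mult_left_mono) auto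
      finally show ?thesis by (simp add: ennreal_mult mult_ac)
    qed
    then have "(\<integral>\<^sup>+z. (\<integral>\<^sup>+x. ennreal \<bar>W t x s z - W t0 x s z\<bar> \<partial>lborel) \<partial>lborel)
      \<le> (\<integral>\<^sup>+z. ennreal \<bar>K z\<bar> * (ennreal B * ennreal \<bar>k (t - s) - k (t0 - s)\<bar>)
            + ennreal \<bar>k (t0 - s)\<bar> * (ennreal \<bar>K z\<bar> * m s z) \<partial>lborel)"
      by (rule nn_integral_mono)
    also have "\<dots> = K_mass * (ennreal B * ennreal \<bar>k (t - s) - k (t0 - s)\<bar>)
       + ennreal \<bar>k (t0 - s)\<bar> * (\<integral>\<^sup>+z. ennreal \<bar>K z\<bar> * m s z \<partial>lborel)"
      by (subst nn_integral_add) (auto simp: nn_integral_cmult nn_integral_multc K_mass_def)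
    finally show ?case by (simp add: mult.assoc)
  qed
  also have "\<dots> = K_mass * ennreal B * (\<integral>\<^sup>+s. ennreal \<bar>k (t - s) - k (t0 - s)\<bar> \<partial>lborel)
      + (\<integral>\<^sup>+s. ennreal \<bar>k (t0 - s)\<bar> * (\<integral>\<^sup>+z. ennreal \<bar>K z\<bar> * m s z \<partial>lborel) \<partial>lborel)"
    by (subst nn_integral_add) (auto simp: nn_integral_cmult)
  also have "(\<integral>\<^sup>+s. ennreal \<bar>k (t - s) - k (t0 - s)\<bar> \<partial>lborel) = translation_modulus k (t0 - t)"
    using nn_integral_reflect[of "\<lambda>s. ennreal \<bar>k (s - (t0 - t)) - k s\<bar>" t0]
    by (simp add: translation_modulus_def)
  finally show ?thesis unfolding m_def .
qed

text \<open>
  Continuity of translations in \<open>L\<^sup>1\<close> is applied to \<open>k\<close>, so that a singularity of \<open>k\<close> does no harm, and for almost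
  every \<open>s\<close> to the slice \<open>F(\<cdot>,s)\<close>; the integral over \<open>s\<close> of the second contribution is a dominated limit.
\<close>

lemma duhamel_average_tendsto:
  assumes t: "t \<longlonglongrightarrow> t0"
  shows "(\<lambda>n. \<integral>\<^sup>+x. ennreal \<bar>duhamel_average k l K F (t n) x - duhamel_average k l K F t0 x\<bar> \<partial>lborel) \<longlonglongrightarrow> 0"
proof -
  define J where "J n s = (\<integral>\<^sup>+z. ennreal \<bar>K z\<bar> *
     translation_modulus (\<lambda>x. F (x, s)) ((l (t n - s) - l (t0 - s)) *\<^sub>R z) \<partial>lborel)" for n s
  have [measurable]: "J n \<in> borel_measurable borel" for n
    unfolding J_def translation_modulus_def by measurable
  have "(\<lambda>n. t0 - t n) \<longlonglongrightarrow> t0 - t0" using t by (intro tendsto_intros)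
  then have "(\<lambda>n. translation_modulus k (t0 - t n)) \<longlonglongrightarrow> 0"
    by (intro translation_modulus_tendsto k) simp
  then have first: "(\<lambda>n. K_mass * ennreal B * translation_modulus k (t0 - t n)) \<longlonglongrightarrow> K_mass * ennreal B * 0"
    using mass_finite by (intro ennreal_tendsto_cmult) (auto simp: ennreal_mult_less_top)
  have "(\<lambda>n. \<integral>\<^sup>+s. ennreal \<bar>k (t0 - s)\<bar> * J n s \<partial>lborel) \<longlonglongrightarrow> integral\<^sup>N lborel (\<lambda>s::real. 0)"
  proof (rule nn_integral_dominated_convergence[where w="\<lambda>s. ennreal \<bar>k (t0 - s)\<bar> * (K_mass * (2 * ennreal B))"])
    show "AE s in lborel. ennreal \<bar>k (t0 - s)\<bar> * J n s \<le> ennreal \<bar>k (t0 - s)\<bar> * (K_mass * (2 * ennreal B))" for n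
      using F_bound
    proof eventually_elim
      case (elim s)
      have "J n s \<le> (\<integral>\<^sup>+z. ennreal \<bar>K z\<bar> * (2 * ennreal B) \<partial>lborel)"
        unfolding J_def using elim
        by (intro nn_integral_mono mult_left_mono order_trans[OF translation_modulus_le_norm]) auto
      also have "\<dots> = K_mass * (2 * ennreal B)" unfolding K_mass_def by (rule nn_integral_multc) measurable
      finally show ?case by (intro mult_left_mono) auto
    qed
    have "(\<integral>\<^sup>+s. ennreal \<bar>k (t0 - s)\<bar> * (K_mass * (2 * ennreal B)) \<partial>lborel) = k_mass * (K_mass * (2 * ennreal B))"
      using nn_integral_reflect[of "\<lambda>s. ennreal \<bar>k s\<bar>" t0] by (simp add: nn_integral_multc k_mass_def)
    also have "\<dots> < \<infinity>" using mass_finite by (auto simp: ennreal_mult_less_top)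
    finally show "(\<integral>\<^sup>+s. ennreal \<bar>k (t0 - s)\<bar> * (K_mass * (2 * ennreal B)) \<partial>lborel) < \<infinity>" .
    show "AE s in lborel. (\<lambda>n. ennreal \<bar>k (t0 - s)\<bar> * J n s) \<longlonglongrightarrow> 0"
      using F_bound
    proof eventually_elim
      case (elim s)
      have "integrable lborel (\<lambda>x. F (x, s))"
        using order.strict_trans1[OF elim, of \<infinity>] by (auto simp: integrable_iff_bounded)
      moreover have "(\<lambda>n. l (t n - s) - l (t0 - s)) \<longlonglongrightarrow> 0"
      proof -
        have "(\<lambda>n. l (t n - s)) \<longlonglongrightarrow> l (t0 - s)"
          using l t by (intro isCont_tendsto_compose[of _ l] tendsto_intros) (auto simp: continuous_on_eq_continuous_at)
        then show ?thesis by (simp add: LIM_zero)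
      qed
      ultimately have "(\<lambda>n. J n s) \<longlonglongrightarrow> 0"
        unfolding J_def by (intro averaged_translation_modulus_tendsto K)
      then have "(\<lambda>n. ennreal \<bar>k (t0 - s)\<bar> * J n s) \<longlonglongrightarrow> ennreal \<bar>k (t0 - s)\<bar> * 0"
        by (intro ennreal_tendsto_cmult) auto
      then show ?case by simp
    qed
  qed measurable
  then have "(\<lambda>n. K_mass * ennreal B * translation_modulus k (t0 - t n)
      + (\<integral>\<^sup>+s. ennreal \<bar>k (t0 - s)\<bar> * J n s \<partial>lborel)) \<longlonglongrightarrow> 0 + 0"
    using first by (intro tendsto_add) simp_all
  then have lim: "(\<lambda>n. K_mass * ennreal B * translation_modulus k (t0 - t n)
      + (\<integral>\<^sup>+s. ennreal \<bar>k (t0 - s)\<bar> * J n s \<partial>lborel)) \<longlonglongrightarrow> 0" by simp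
  show ?thesis
    by (rule tendsto_sandwich[OF _ _ tendsto_const lim])
       (simp_all add: J_def duhamel_average_diff_bound)
qed

end

section \<open>Self-similarity of the two kernels\<close>

text \<open>
  The spatial length belonging to time \<open>t\<close>. The truncation at 0 gives a continuous function on the whole line.
\<close>

definition parabolic_scale :: "real \<Rightarrow> real \<Rightarrow> real \<Rightarrow> real" where
  "parabolic_scale \<alpha> \<beta> t = (max 0 t) powr (\<alpha> / (2 * \<beta>))"

lemma parabolic_scale_0 [simp]: "parabolic_scale \<alpha> \<beta> 0 = 0"
  by (simp add: parabolic_scale_def)

lemma continuous_on_parabolic_scale:
  assumes "0 < \<alpha>" "0 < \<beta>"
  shows "continuous_on UNIV (parabolic_scale \<alpha> \<beta>)"
  unfolding parabolic_scale_def using assms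
  by (intro continuous_on_powr' continuous_intros) auto

lemma norm_scaled_powr:
  fixes \<xi> :: "'a::real_normed_vector"
  assumes "0 < \<alpha>" "0 < \<beta>" "0 < t"
  shows "norm (parabolic_scale \<alpha> \<beta> t *\<^sub>R \<xi>) powr (2 * \<beta>) = norm \<xi> powr (2 * \<beta>) * t powr \<alpha>"
  using assms by (simp add: parabolic_scale_def powr_mult powr_powr mult.commute)

lemma fourier_kernel_Z_scaling:
  assumes "is_kernel_Z \<alpha> \<beta> Z" "0 < \<alpha>" "0 < \<beta>" "0 < t"
  shows "fourier (\<lambda>x. Z x t) \<xi> = complex_of_real 1 * fourier (\<lambda>x. Z x 1) (parabolic_scale \<alpha> \<beta> t *\<^sub>R \<xi>)"
  using assms norm_scaled_powr[of \<alpha> \<beta> t \<xi>] by (simp add: is_kernel_Z_def)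

lemma fourier_kernel_Y_scaling:
  assumes "is_kernel_Y \<alpha> \<beta> Y" "0 < \<alpha>" "0 < \<beta>" "0 < t"
  shows "fourier (\<lambda>x. Y x t) \<xi>
     = complex_of_real (t powr (\<alpha> - 1)) * fourier (\<lambda>x. Y x 1) (parabolic_scale \<alpha> \<beta> t *\<^sub>R \<xi>)"
  using assms norm_scaled_powr[of \<alpha> \<beta> t \<xi>] by (simp add: is_kernel_Y_def)

text \<open>
  The integral is the value of the Fourier transform at 0.
\<close>

lemma kernel_Z_mass:
  assumes Z: "is_kernel_Z \<alpha> \<beta> Z"
  shows "(LINT x|lborel. Z x 1) = 1"
proof -
  have "complex_of_real (LINT x|lborel. Z x 1) = fourier (\<lambda>x. Z x 1) 0"
    by (simp add: fourier_def)
  also have "\<dots> = complex_of_real (mittag_leffler \<alpha> 1 0)"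
    using Z by (simp add: is_kernel_Z_def)
  also have "mittag_leffler \<alpha> 1 0 = 1"
    using powser_zero[of "\<lambda>k. 1 / Gamma (\<alpha> * real k + 1) :: real"]
    by (simp add: mittag_leffler_def)
  finally show ?thesis by simp
qed

text \<open>
  The weight \<open>s\<^sup>\<alpha>\<^sup>-\<^sup>1\<close> of the kernel \<open>Y\<close>, cut off at \<open>\<tau>\<close> to be integrable over the whole line.
  For a source supported in positive times the cut-off does not affect the Duhamel integral before time \<open>\<tau>\<close>.
\<close>

definition cut_powr :: "real \<Rightarrow> real \<Rightarrow> real \<Rightarrow> real" where
  "cut_powr \<alpha> \<tau> s = (if 0 < s \<and> s < \<tau> then s powr (\<alpha> - 1) else 0)"

lemma integrable_cut_powr:
  assumes "0 < \<alpha>" "0 < \<tau>"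
  shows "integrable lborel (cut_powr \<alpha> \<tau>)"
proof -
  have m: "cut_powr \<alpha> \<tau> \<in> borel_measurable borel" unfolding cut_powr_def by measurable
  have "(\<integral>\<^sup>+s. ennreal (norm (cut_powr \<alpha> \<tau> s)) \<partial>lborel) \<le> (\<integral>\<^sup>+s. ennreal (s powr (\<alpha> - 1)) * indicator {0..\<tau>} s \<partial>lborel)"
    by (intro nn_integral_mono) (auto simp: cut_powr_def indicator_def)
  also have "\<dots> = ennreal (\<tau> powr (\<alpha> - 1 + 1) / (\<alpha> - 1 + 1))"
    using assms by (intro nn_integral_has_integral_lebesgue' has_integral_powr_from_0) auto
  also have "\<dots> < \<infinity>" by simp
  finally show ?thesis using m by (simp add: integrable_iff_bounded)
qed

section \<open>Bounds for \<open>L\<^sup>m\<close> norms\<close>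

lemma powr_integral_le_of_Lm_norm_le:
  assumes f: "in_Lm m f" and le: "Lm_norm m f \<le> M" and m: "0 < m"
  shows "(\<integral>\<^sup>+x. ennreal (\<bar>f x\<bar> powr m) \<partial>lborel) \<le> ennreal (\<bar>M\<bar> powr m)"
proof -
  define I where "I = (LINT x|lborel. \<bar>f x\<bar> powr m)"
  have I: "0 \<le> I" unfolding I_def by (intro integral_nonneg_AE) auto
  have "I = (I powr (1 / m)) powr m" using I m by (simp add: powr_powr)
  also have "\<dots> \<le> \<bar>M\<bar> powr m"
    using le m by (intro powr_mono2) (auto simp: Lm_norm_def I_def)
  finally show ?thesis
    using f by (simp add: in_Lm_def nn_integral_eq_integral I_def ennreal_leI)
qed

lemma Lm_norm_le_of_powr_integral_le:
  assumes f: "in_Lm m f" and le: "(\<integral>\<^sup>+x. ennreal (\<bar>f x\<bar> powr m) \<partial>lborel) \<le> ennreal C" and m: "0 < m" and C: "0 \<le> C"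
  shows "Lm_norm m f \<le> C powr (1 / m)"
proof -
  have "(LINT x|lborel. \<bar>f x\<bar> powr m) \<le> C"
    using f le C by (simp add: in_Lm_def nn_integral_eq_integral)
  then show ?thesis
    unfolding Lm_norm_def using m by (intro powr_mono2) (auto intro!: integral_nonneg_AE)
qed

lemma nn_integral_powr_add_le:
  fixes f g :: "'b \<Rightarrow> real"
  assumes [measurable]: "f \<in> borel_measurable M" "g \<in> borel_measurable M" and m: "0 \<le> m"
  shows "(\<integral>\<^sup>+x. ennreal (\<bar>f x + g x\<bar> powr m) \<partial>M)
    \<le> ennreal (2 powr m) * ((\<integral>\<^sup>+x. ennreal (\<bar>f x\<bar> powr m) \<partial>M) + (\<integral>\<^sup>+x. ennreal (\<bar>g x\<bar> powr m) \<partial>M))"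
proof -
  have "(\<integral>\<^sup>+x. ennreal (\<bar>f x + g x\<bar> powr m) \<partial>M)
    \<le> (\<integral>\<^sup>+x. ennreal (2 powr m) * (ennreal (\<bar>f x\<bar> powr m) + ennreal (\<bar>g x\<bar> powr m)) \<partial>M)"
    using powr_add_abs_le[OF m]
    by (intro nn_integral_mono) (simp add: ennreal_plus[symmetric] ennreal_mult[symmetric] ennreal_leI del: ennreal_plus)
  also have "\<dots> = ennreal (2 powr m) * ((\<integral>\<^sup>+x. ennreal (\<bar>f x\<bar> powr m) \<partial>M) + (\<integral>\<^sup>+x. ennreal (\<bar>g x\<bar> powr m) \<partial>M))"
    by (simp add: nn_integral_cmult nn_integral_add)
  finally show ?thesis .
qed

lemma AE_lborel_exists_between:
  fixes a b :: real
  assumes P: "AE t in lborel. P t" and ab: "a < b"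
  shows "\<exists>t. a < t \<and> t < b \<and> P t"
proof (rule ccontr)
  assume "\<not> ?thesis"
  then have "AE t in lborel. t \<notin> {a<..<b}" using P by (auto elim!: eventually_mono)
  then have "emeasure lborel {a<..<b} = 0"
    by (subst (asm) AE_iff_measurable[of "{a<..<b}"]) auto
  then show False using ab by simp
qed

section \<open>Linear and nonlinear part of a solution\<close>

text \<open>
  The exponent exceeds 1 because it is to be larger than some \<open>q \<ge> 1\<close>.
\<close>

locale fractional_solution =
  fixes \<alpha> \<beta> p :: real and Z Y u :: "'a::euclidean_space \<Rightarrow> real \<Rightarrow> real" and u0 :: "'a \<Rightarrow> real" and T :: ereal
  assumes \<alpha>: "0 < \<alpha>" and \<beta>: "0 < \<beta>" and Z: "is_kernel_Z \<alpha> \<beta> Z" and Y: "is_kernel_Y \<alpha> \<beta> Y"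
    and p: "1 < p" and sol: "Lm_solution Z Y p p u0 T u"
begin

abbreviation l :: "real \<Rightarrow> real" where "l \<equiv> parabolic_scale \<alpha> \<beta>"

lemma l_pos: "0 < t \<Longrightarrow> 0 < l t" by (simp add: parabolic_scale_def)

lemma Z_integrable: "0 < t \<Longrightarrow> integrable lborel (\<lambda>x. Z x t)"
  using Z by (simp add: is_kernel_Z_def)

lemma Y_integrable: "0 < t \<Longrightarrow> integrable lborel (\<lambda>x. Y x t)"
  using Y by (simp add: is_kernel_Y_def)

lemma u0_Lp: "in_Lm p u0" using sol by (simp add: Lm_solution_def)

lemma u0_measurable [measurable]: "u0 \<in> borel_measurable borel"
  using u0_Lp by (simp add: in_Lm_iff)

definition linear_part :: "real \<Rightarrow> 'a \<Rightarrow> real" where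
  "linear_part t = dilation_average (\<lambda>x. Z x 1) u0 (l t)"

text \<open>
  Self-similarity of \<open>Z\<close> identifies the average with the convolution in the integral equation.
\<close>

lemma linear_part_eq:
  assumes "0 < t"
  shows "linear_part t x = (LINT y|lborel. u0 y * Z (x - y) t)"
  unfolding linear_part_def dilation_average_def
  using dilated_kernel_convolution(1)[OF Z_integrable[OF assms] Z_integrable[of 1] l_pos[OF assms]
      fourier_kernel_Z_scaling[OF Z \<alpha> \<beta> assms] u0_measurable, of x]
  by simp

lemma linear_part_0: "linear_part 0 x = u0 x"
  by (simp add: linear_part_def dilation_average_def kernel_Z_mass[OF Z])

lemma linear_part_measurable [measurable]: "linear_part t \<in> borel_measurable borel"
  unfolding linear_part_def using Z_integrable[of 1]
  by (intro dilation_average_measurable) auto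

lemma linear_part_bound:
  assumes u0: "in_Lm m u0" and m: "1 \<le> m"
  obtains C where "0 \<le> C" "\<And>t. (\<integral>\<^sup>+x. ennreal (\<bar>linear_part t x\<bar> powr m) \<partial>lborel) \<le> ennreal C"
proof -
  define C where "C = ennreal ((LINT z|lborel. \<bar>Z z 1\<bar>) powr (m - 1)) *
         ((\<integral>\<^sup>+z. ennreal \<bar>Z z 1\<bar> \<partial>lborel) * (\<integral>\<^sup>+x. ennreal (\<bar>u0 x\<bar> powr m) \<partial>lborel))"
  have "C < \<infinity>"
    using u0 Z_integrable[of 1] by (auto simp: C_def in_Lm_iff integrable_iff_bounded ennreal_mult_less_top)
  then have "C = ennreal (enn2real C)" by simp
  moreover have "(\<integral>\<^sup>+x. ennreal (\<bar>linear_part t x\<bar> powr m) \<partial>lborel) \<le> C" for t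
    unfolding C_def linear_part_def by (rule dilation_average_bound(2)[OF u0 _ m]) (use Z_integrable in simp)
  ultimately show ?thesis by (intro that[of "enn2real C"]) auto
qed

lemma linear_part_tendsto:
  assumes u0: "in_Lm m u0" and m: "1 \<le> m" and t: "t \<longlonglongrightarrow> t0"
  shows "(\<lambda>n. \<integral>\<^sup>+x. ennreal (\<bar>linear_part (t n) x - linear_part t0 x\<bar> powr m) \<partial>lborel) \<longlonglongrightarrow> 0"
proof -
  have "isCont l t0"
    using continuous_on_parabolic_scale[OF \<alpha> \<beta>] by (simp add: continuous_on_eq_continuous_at)
  then have "(\<lambda>n. l (t n)) \<longlonglongrightarrow> l t0" using t by (rule isCont_tendsto_compose)
  then show ?thesis
    unfolding linear_part_def by (intro dilation_average_tendsto[OF u0 _ m]) (use Z_integrable in simp_all)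
qed

lemma linear_part_integrable:
  assumes u0: "in_Lm m u0" and m: "1 \<le> m" and t: "0 < t"
  shows "AE x in lborel. integrable lborel (\<lambda>y. u0 y * Z (x - y) t)"
  using dilation_average_bound(1)[OF u0 Z_integrable[OF zero_less_one] m, of "l t"]
proof eventually_elim
  case (elim x)
  have [measurable]: "(\<lambda>x. Z x t) \<in> borel_measurable borel" using Z_integrable[OF t] by auto
  have m: "(\<lambda>y. u0 y * Z (x - y) t) \<in> borel_measurable borel" by measurable
  have "(\<integral>\<^sup>+y. ennreal \<bar>u0 y * Z (x - y) t\<bar> \<partial>lborel) < \<infinity>"
    using dilated_kernel_convolution(2)[OF Z_integrable[OF t] Z_integrable[of 1] l_pos[OF t]
      fourier_kernel_Z_scaling[OF Z \<alpha> \<beta> t] u0_measurable, of x] elim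
    by (simp add: integrable_iff_bounded)
  then show ?case using m by (simp add: integrable_iff_bounded)
qed

text \<open>
  The nonlinearity on the time interval \<open>(0,\<tau>)\<close>, where \<open>\<tau> < T\<close>, extended by 0 to a Borel function on the whole
  space-time. Its slices are bounded in \<open>L\<^sup>1\<close> because those of \<open>u\<close> are bounded in \<open>L\<^sup>p\<close>.
\<close>

definition source :: "real \<Rightarrow> 'a \<times> real \<Rightarrow> real" where
  "source \<tau> w = (if 0 < snd w \<and> snd w < \<tau> then \<bar>u (fst w) (snd w)\<bar> powr (p - 1) * u (fst w) (snd w) else 0)"

lemma source_measurable:
  assumes \<tau>: "ereal \<tau> < T"
  shows "source \<tau> \<in> borel_measurable borel"
proof -
  let ?S = "{t. 0 < t \<and> ereal t < T}"
  have S: "UNIV \<times> ?S \<in> sets (borel :: ('a \<times> real) measure)"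
  proof -
    have "?S \<in> sets borel" by measurable
    then show ?thesis by (subst borel_prod[symmetric]) auto
  qed
  have "(\<lambda>(x, t). u x t) \<in> borel_measurable (restrict_space borel (UNIV \<times> ?S))"
    using sol by (simp add: Lm_solution_def Linf_loc_Lm_def)
  then have U: "(\<lambda>w. if w \<in> UNIV \<times> ?S then (\<lambda>(x, t). u x t) w else 0) \<in> borel_measurable borel" (is "?U \<in> _")
    using S by (subst (asm) measurable_restrict_space_iff) auto
  have snd [measurable]: "snd \<in> borel_measurable (borel :: ('a \<times> real) measure)"
    by (intro borel_measurable_continuous_onI continuous_intros)
  note [measurable] = U
  have "(\<lambda>w. if 0 < snd w \<and> snd w < \<tau> then \<bar>?U w\<bar> powr (p - 1) * ?U w else 0) \<in> borel_measurable borel"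
    by measurable
  also have "(\<lambda>w. if 0 < snd w \<and> snd w < \<tau> then \<bar>?U w\<bar> powr (p - 1) * ?U w else 0) = source \<tau>"
  proof
    fix w :: "'a \<times> real"
    have "ereal (snd w) < T" if "snd w < \<tau>"
      using that \<tau> by (meson ereal_less_eq(3) less_imp_le order.strict_trans1)
    then show "(if 0 < snd w \<and> snd w < \<tau> then \<bar>?U w\<bar> powr (p - 1) * ?U w else 0) = source \<tau> w"
      by (auto simp: source_def split_beta mem_Times_iff)
  qed
  finally show ?thesis .
qed

lemma abs_source: "\<bar>\<bar>v\<bar> powr (p - 1) * v\<bar> = \<bar>v\<bar> powr p"
  by (cases "v = 0") (auto simp: abs_mult powr_diff)

lemma u_Lp_bound:
  assumes \<tau>: "0 < \<tau>" "ereal \<tau> < T"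
  obtains B where "0 \<le> B" "AE t in lborel. 0 < t \<and> t < \<tau> \<longrightarrow>
     in_Lm p (\<lambda>x. u x t) \<and> (\<integral>\<^sup>+x. ennreal (\<bar>u x t\<bar> powr p) \<partial>lborel) \<le> ennreal B"
proof -
  obtain M where "AE t in lborel. 0 < t \<and> t < \<tau> \<longrightarrow> in_Lm p (\<lambda>x. u x t) \<and> Lm_norm p (\<lambda>x. u x t) \<le> M"
    using sol \<tau> unfolding Lm_solution_def Linf_loc_Lm_def by blast
  then have "AE t in lborel. 0 < t \<and> t < \<tau> \<longrightarrow>
     in_Lm p (\<lambda>x. u x t) \<and> (\<integral>\<^sup>+x. ennreal (\<bar>u x t\<bar> powr p) \<partial>lborel) \<le> ennreal (\<bar>M\<bar> powr p)"
    by eventually_elim (use p in \<open>auto intro!: powr_integral_le_of_Lm_norm_le\<close>)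
  then show ?thesis by (intro that) auto
qed

lemma duhamel_data_source:
  assumes \<tau>: "0 < \<tau>" "ereal \<tau> < T"
  obtains B where "duhamel_data (cut_powr \<alpha> \<tau>) l (\<lambda>x. Y x 1) (source \<tau>) B"
proof -
  obtain B where B: "0 \<le> B" and bd: "AE t in lborel. 0 < t \<and> t < \<tau> \<longrightarrow>
     in_Lm p (\<lambda>x. u x t) \<and> (\<integral>\<^sup>+x. ennreal (\<bar>u x t\<bar> powr p) \<partial>lborel) \<le> ennreal B"
    using u_Lp_bound[OF \<tau>] .
  have "duhamel_data (cut_powr \<alpha> \<tau>) l (\<lambda>x. Y x 1) (source \<tau>) B"
  proof
    show "AE s in lborel. (\<integral>\<^sup>+x. ennreal \<bar>source \<tau> (x, s)\<bar> \<partial>lborel) \<le> ennreal B"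
      using bd
    proof eventually_elim
      case (elim s)
      show ?case
      proof (cases "0 < s \<and> s < \<tau>")
        case True
        then show ?thesis using elim by (simp add: source_def abs_source)
      next
        case False
        then have "source \<tau> (x, s) = 0" for x by (auto simp: source_def)
        then show ?thesis by simp
      qed
    qed
  qed (use B \<tau> \<alpha> \<beta> in \<open>auto intro: integrable_cut_powr continuous_on_parabolic_scale Y_integrable source_measurable\<close>)
  then show ?thesis by (rule that)
qed

text \<open>
  For \<open>0 < t < \<tau>\<close> the value does not depend on \<open>\<tau>\<close>; it is the Duhamel integral at time \<open>t\<close>.
\<close>

definition nonlinear_part :: "real \<Rightarrow> real \<Rightarrow> 'a \<Rightarrow> real" where
  "nonlinear_part \<tau> = duhamel_average (cut_powr \<alpha> \<tau>) l (\<lambda>x. Y x 1) (source \<tau>)"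

lemma source_slice_convolution:
  assumes \<tau>: "ereal \<tau> < T" and t: "0 < t" "t < \<tau>" and s: "0 < s" "s < t"
  shows "(LINT y|lborel. \<bar>u y s\<bar> powr (p - 1) * u y s * Y (x - y) (t - s))
      = (LINT z|lborel. cut_powr \<alpha> \<tau> (t - s) * (source \<tau> (x - l (t - s) *\<^sub>R z, s) * Y z 1))"
    and "(\<integral>\<^sup>+y. ennreal \<bar>\<bar>u y s\<bar> powr (p - 1) * u y s * Y (x - y) (t - s)\<bar> \<partial>lborel)
      = (\<integral>\<^sup>+z. ennreal \<bar>cut_powr \<alpha> \<tau> (t - s) * (source \<tau> (x - l (t - s) *\<^sub>R z, s) * Y z 1)\<bar> \<partial>lborel)"
proof -
  note [measurable] = source_measurable[OF \<tau>]
  have [measurable]: "(\<lambda>z. Y z 1) \<in> borel_measurable borel" using Y_integrable[of 1] by auto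
  have ts: "0 < t - s" using s by simp
  have g: "(\<lambda>y. source \<tau> (y, s)) \<in> borel_measurable borel" by measurable
  have cut: "cut_powr \<alpha> \<tau> (t - s) = (t - s) powr (\<alpha> - 1)" using s t by (simp add: cut_powr_def)
  have src: "source \<tau> (y, s) = \<bar>u y s\<bar> powr (p - 1) * u y s" for y using s t by (simp add: source_def)
  note conv = dilated_kernel_convolution[OF Y_integrable[OF ts] Y_integrable[of 1] l_pos[OF ts]
      fourier_kernel_Y_scaling[OF Y \<alpha> \<beta> ts] g, of x]
  show "(LINT y|lborel. \<bar>u y s\<bar> powr (p - 1) * u y s * Y (x - y) (t - s))
      = (LINT z|lborel. cut_powr \<alpha> \<tau> (t - s) * (source \<tau> (x - l (t - s) *\<^sub>R z, s) * Y z 1))"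
    using conv(1) by (simp add: src cut)
  have "(\<integral>\<^sup>+z. ennreal \<bar>cut_powr \<alpha> \<tau> (t - s) * (source \<tau> (x - l (t - s) *\<^sub>R z, s) * Y z 1)\<bar> \<partial>lborel)
     = (\<integral>\<^sup>+z. ennreal \<bar>(t - s) powr (\<alpha> - 1)\<bar> * ennreal \<bar>source \<tau> (x - l (t - s) *\<^sub>R z, s) * Y z 1\<bar> \<partial>lborel)"
    unfolding cut by (intro nn_integral_cong) (simp add: abs_mult ennreal_mult)
  also have "\<dots> = ennreal \<bar>(t - s) powr (\<alpha> - 1)\<bar> * (\<integral>\<^sup>+z. ennreal \<bar>source \<tau> (x - l (t - s) *\<^sub>R z, s) * Y z 1\<bar> \<partial>lborel)"
    by (rule nn_integral_cmult) measurable
  finally show "(\<integral>\<^sup>+y. ennreal \<bar>\<bar>u y s\<bar> powr (p - 1) * u y s * Y (x - y) (t - s)\<bar> \<partial>lborel)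
      = (\<integral>\<^sup>+z. ennreal \<bar>cut_powr \<alpha> \<tau> (t - s) * (source \<tau> (x - l (t - s) *\<^sub>R z, s) * Y z 1)\<bar> \<partial>lborel)"
    using conv(2) by (simp add: src)
qed

lemma nonlinear_part_eq:
  assumes \<tau>: "ereal \<tau> < T" and t: "0 < t" "t < \<tau>"
  shows "nonlinear_part \<tau> t x =
     (LINT s:{0<..<t}|lborel. (LINT y|lborel. \<bar>u y s\<bar> powr (p - 1) * u y s * Y (x - y) (t - s)))"
  unfolding nonlinear_part_def duhamel_average_def set_lebesgue_integral_def
proof (rule Bochner_Integration.integral_cong[OF refl])
  fix s :: real
  show "(LINT z|lborel. cut_powr \<alpha> \<tau> (t - s) * (source \<tau> (x - l (t - s) *\<^sub>R z, s) * Y z 1))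
    = indicator {0<..<t} s *\<^sub>R (LINT y|lborel. \<bar>u y s\<bar> powr (p - 1) * u y s * Y (x - y) (t - s))"
  proof (cases "0 < s \<and> s < t")
    case True
    then show ?thesis using source_slice_convolution(1)[OF \<tau> t, of s x] by simp
  next
    case False
    then show ?thesis by (auto simp: source_def cut_powr_def)
  qed
qed

lemma nonlinear_part_0: "nonlinear_part \<tau> 0 x = 0"
proof -
  have "(LINT z|lborel. cut_powr \<alpha> \<tau> (0 - s) * (source \<tau> (x - l (0 - s) *\<^sub>R z, s) * Y z 1)) = 0" for s
    by (cases "s < 0") (simp_all add: cut_powr_def source_def)
  then have "nonlinear_part \<tau> 0 x = (LINT s::real|lborel. 0)"
    unfolding nonlinear_part_def duhamel_average_def by (intro Bochner_Integration.integral_cong) (simp_all only:)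
  then show ?thesis by simp
qed

lemma representative_eq:
  assumes \<tau>: "ereal \<tau> < T" and t: "0 \<le> t" "t < \<tau>"
  shows "duhamel_representative Z Y p u0 u x t = linear_part t x + nonlinear_part \<tau> t x"
  using t nonlinear_part_eq[OF \<tau>, of t x] linear_part_eq[of t x]
  by (auto simp: duhamel_representative_def duhamel_rhs_def linear_part_0 nonlinear_part_0)

text \<open>
  The norm bounds for both parts control the integrals of the absolute values as well, and they hold
  at every \<open>t > 0\<close>, not only at almost every one. Finite norms make these integrals finite for almost every \<open>x\<close>.
\<close>

lemma duhamel_converges_all:
  assumes t: "0 < t" "ereal t < T"
  shows "duhamel_converges Z Y p u0 u t"
proof -
  obtain \<tau> where \<tau>: "t < \<tau>" "ereal \<tau> < T" using ereal_dense2[OF t(2)] by auto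
  then have \<tau>0: "0 < \<tau>" using t by simp
  obtain B where "duhamel_data (cut_powr \<alpha> \<tau>) l (\<lambda>x. Y x 1) (source \<tau>) B"
    using duhamel_data_source[OF \<tau>0 \<tau>(2)] .
  then interpret D: duhamel_data "cut_powr \<alpha> \<tau>" l "\<lambda>x. Y x 1" "source \<tau>" B .
  (* Y is measurable for positive times only; its extension by 0 is Borel on the whole space. *)
  define Y' where "Y' w = (if w \<in> UNIV \<times> {0<..} then (\<lambda>(x, t). Y x t) w else 0)" for w :: "'a \<times> real"
  have Y' [measurable]: "Y' \<in> borel_measurable borel"
  proof -
    have "UNIV \<times> {0<..} \<in> sets (borel :: ('a \<times> real) measure)"
      by (subst borel_prod[symmetric]) auto
    moreover have "(\<lambda>(x, t). Y x t) \<in> borel_measurable (restrict_space borel (UNIV \<times> {0<..}))"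
      using Y by (simp add: is_kernel_Y_def)
    ultimately show ?thesis
      unfolding Y'_def by (subst (asm) measurable_restrict_space_iff) auto
  qed
  have slice: "(\<integral>\<^sup>+y. ennreal \<bar>(if 0 < s \<and> s < t then source \<tau> (y, s) * Y' (x - y, t - s) else 0)\<bar> \<partial>lborel)
      \<le> (\<integral>\<^sup>+z. ennreal \<bar>cut_powr \<alpha> \<tau> (t - s) * (source \<tau> (x - l (t - s) *\<^sub>R z, s) * Y z 1)\<bar> \<partial>lborel)" for x s
    using source_slice_convolution(2)[OF \<tau>(2) t(1) \<tau>(1), of s x] \<tau>
    by (cases "0 < s \<and> s < t") (auto simp: Y'_def source_def)
  have "AE x in lborel. set_integrable lborel (UNIV \<times> {0<..<t})
          (\<lambda>(y, s). \<bar>u y s\<bar> powr (p - 1) * u y s * Y (x - y) (t - s))"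
    using D.AE_W_finite[of t]
  proof eventually_elim
    case (elim x)
    define G where "G w = (if 0 < snd w \<and> snd w < t then source \<tau> w * Y' (x - fst w, t - snd w) else 0)" for w
    have G_eq: "indicator (UNIV \<times> {0<..<t}) w *\<^sub>R (case w of (y, s) \<Rightarrow> \<bar>u y s\<bar> powr (p - 1) * u y s * Y (x - y) (t - s)) = G w" for w
      using \<tau> by (auto simp: G_def Y'_def source_def indicator_def split: prod.splits)
    have src [measurable]: "source \<tau> \<in> borel_measurable (lborel \<Otimes>\<^sub>M lborel)"
      using source_measurable[OF \<tau>(2)] by (simp add: lborel_prod)
    have [measurable]: "G \<in> borel_measurable (lborel \<Otimes>\<^sub>M lborel)"
      unfolding G_def by measurable
    have "(\<integral>\<^sup>+w. ennreal (norm (G w)) \<partial>(lborel \<Otimes>\<^sub>M lborel)) = (\<integral>\<^sup>+s. (\<integral>\<^sup>+y. ennreal (norm (G (y, s))) \<partial>lborel) \<partial>lborel)"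
      by (rule lborel_pair.nn_integral_snd[symmetric]) measurable
    also have "\<dots> \<le> (\<integral>\<^sup>+s. (\<integral>\<^sup>+z. ennreal \<bar>cut_powr \<alpha> \<tau> (t - s) * (source \<tau> (x - l (t - s) *\<^sub>R z, s) * Y z 1)\<bar> \<partial>lborel) \<partial>lborel)"
      unfolding G_def real_norm_def fst_conv snd_conv by (rule nn_integral_mono) (rule slice)
    also have "\<dots> < \<infinity>" by (rule elim)
    finally have "integrable (lborel \<Otimes>\<^sub>M lborel) G" by (simp add: integrable_iff_bounded)
    then show ?case unfolding set_integrable_def G_eq by (simp add: lborel_prod)
  qed
  moreover have "AE x in lborel. integrable lborel (\<lambda>y. u0 y * Z (x - y) t)"
    using p by (intro linear_part_integrable[OF u0_Lp _ t(1)]) simp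
  ultimately show ?thesis unfolding duhamel_converges_def by eventually_elim simp
qed

end

section \<open>Membership and convergence in \<open>L\<^sup>m\<close>\<close>

lemma powr_dist_tendsto_imp_Lm_norm_tendsto:
  fixes f :: "nat \<Rightarrow> 'a::euclidean_space \<Rightarrow> real"
  assumes [measurable]: "\<And>n. f n \<in> borel_measurable borel" and m: "0 < m"
    and lim: "(\<lambda>n. \<integral>\<^sup>+x. ennreal (\<bar>f n x\<bar> powr m) \<partial>lborel) \<longlonglongrightarrow> 0"
  shows "(\<lambda>n. Lm_norm m (f n)) \<longlonglongrightarrow> 0"
proof -
  have "(\<lambda>n. enn2real (\<integral>\<^sup>+x. ennreal (\<bar>f n x\<bar> powr m) \<partial>lborel)) \<longlonglongrightarrow> 0"
    using lim by (intro tendsto_enn2real) simp_all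
  then have "(\<lambda>n. LINT x|lborel. \<bar>f n x\<bar> powr m) \<longlonglongrightarrow> 0"
    by (subst integral_eq_nn_integral) auto
  then show ?thesis
    unfolding Lm_norm_def using m
    by (intro tendsto_zero_powrI[where b="1 / m"]) (auto intro!: integral_nonneg_AE always_eventually)
qed

lemma in_Lm_add:
  assumes f: "in_Lm m f" and g: "in_Lm m g" and m: "0 \<le> m"
  shows "in_Lm m (\<lambda>x. f x + g x)"
proof -
  have [measurable]: "f \<in> borel_measurable borel" "g \<in> borel_measurable borel" using f g by (auto simp: in_Lm_iff)
  have "(\<integral>\<^sup>+x. ennreal (\<bar>f x + g x\<bar> powr m) \<partial>lborel) < \<infinity>"
    using f g by (intro order.strict_trans1[OF nn_integral_powr_add_le[OF _ _ m]])
       (auto simp: in_Lm_iff ennreal_mult_less_top)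
  then show ?thesis by (simp add: in_Lm_iff)
qed

lemma in_Lm_uminus: "in_Lm m (\<lambda>x. - g x) \<longleftrightarrow> in_Lm m g"
  by (simp add: in_Lm_iff)

lemma in_Lm_diff:
  assumes "in_Lm m f" "in_Lm m g" "0 \<le> m"
  shows "in_Lm m (\<lambda>x. f x - g x)"
  using in_Lm_add[of m f "\<lambda>x. - g x"] assms by (simp add: in_Lm_uminus)

lemma in_Lm_cong_AE:
  assumes "AE x in lborel. f x = g x" "f \<in> borel_measurable borel" and g: "in_Lm m g"
  shows "in_Lm m f"
proof -
  have "(\<integral>\<^sup>+x. ennreal (\<bar>f x\<bar> powr m) \<partial>lborel) = (\<integral>\<^sup>+x. ennreal (\<bar>g x\<bar> powr m) \<partial>lborel)"
    by (rule nn_integral_cong_AE) (use assms(1) in eventually_elim, simp)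
  then show ?thesis using assms(2) g by (simp add: in_Lm_iff)
qed

lemma Lm_norm_cong_AE:
  assumes "AE x in lborel. f x = g x" "f \<in> borel_measurable borel" "g \<in> borel_measurable borel"
  shows "Lm_norm m f = Lm_norm m g"
proof -
  note [measurable] = assms(2,3)
  have "(LINT x|lborel. \<bar>f x\<bar> powr m) = (LINT x|lborel. \<bar>g x\<bar> powr m)"
    by (rule integral_cong_AE, measurable) (use assms(1) in eventually_elim, simp)
  then show ?thesis by (simp add: Lm_norm_def)
qed

section \<open>Regularity of the nonlinear part\<close>

context fractional_solution
begin

lemma nonlinear_part_L1:
  assumes \<tau>: "0 < \<tau>" "ereal \<tau> < T"
  shows "nonlinear_part \<tau> t \<in> borel_measurable borel"
    and "\<exists>C\<ge>0. \<forall>t. (\<integral>\<^sup>+x. ennreal \<bar>nonlinear_part \<tau> t x\<bar> \<partial>lborel) \<le> ennreal C"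
    and "s \<longlonglongrightarrow> t \<Longrightarrow> (\<lambda>n. \<integral>\<^sup>+x. ennreal \<bar>nonlinear_part \<tau> (s n) x - nonlinear_part \<tau> t x\<bar> \<partial>lborel) \<longlonglongrightarrow> 0"
proof -
  obtain B where "duhamel_data (cut_powr \<alpha> \<tau>) l (\<lambda>x. Y x 1) (source \<tau>) B"
    using duhamel_data_source[OF \<tau>] .
  then interpret D: duhamel_data "cut_powr \<alpha> \<tau>" l "\<lambda>x. Y x 1" "source \<tau>" B .
  show "nonlinear_part \<tau> t \<in> borel_measurable borel"
    unfolding nonlinear_part_def by (rule D.duhamel_average_measurable)
  show "s \<longlonglongrightarrow> t \<Longrightarrow> (\<lambda>n. \<integral>\<^sup>+x. ennreal \<bar>nonlinear_part \<tau> (s n) x - nonlinear_part \<tau> t x\<bar> \<partial>lborel) \<longlonglongrightarrow> 0"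
    unfolding nonlinear_part_def by (rule D.duhamel_average_tendsto)
  define C where "C = D.k_mass * (D.K_mass * ennreal B)"
  have "C < \<infinity>" using D.mass_finite by (auto simp: C_def ennreal_mult_less_top)
  then have "C = ennreal (enn2real C)" by simp
  then have "(\<integral>\<^sup>+x. ennreal \<bar>nonlinear_part \<tau> t x\<bar> \<partial>lborel) \<le> ennreal (enn2real C)" for t
    using D.duhamel_average_L1[of t] unfolding nonlinear_part_def C_def by metis
  then show "\<exists>C\<ge>0. \<forall>t. (\<integral>\<^sup>+x. ennreal \<bar>nonlinear_part \<tau> t x\<bar> \<partial>lborel) \<le> ennreal C"
    by (intro exI[of _ "enn2real C"]) auto
qed

lemma AE_solution_formula:
  assumes \<tau>: "0 < \<tau>" "ereal \<tau> < T"
  shows "AE t in lborel. 0 < t \<and> t < \<tau> \<longrightarrow> (AE x in lborel. u x t = linear_part t x + nonlinear_part \<tau> t x)"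
proof -
  have "AE t in lborel. 0 < t \<and> ereal t < T \<longrightarrow> (AE x in lborel. u x t = duhamel_rhs Z Y p u0 u t x)"
    using sol unfolding Lm_solution_def by (auto elim: eventually_mono)
  then show ?thesis
  proof eventually_elim
    case (elim t)
    show ?case
    proof (intro impI)
      assume t: "0 < t \<and> t < \<tau>"
      then have "ereal t < T" using \<tau> by (meson ereal_less_eq(3) less_imp_le order.strict_trans1)
      then have "AE x in lborel. u x t = duhamel_rhs Z Y p u0 u t x" using elim t by simp
      then show "AE x in lborel. u x t = linear_part t x + nonlinear_part \<tau> t x"
      proof eventually_elim
        case (elim x)
        then show ?case
          using representative_eq[OF \<tau>(2), of t x] t by (simp add: duhamel_representative_def)
      qed
    qed
  qed
qed

text \<open>
  At almost every time the nonlinear part is the difference of \<open>u\<close> and the linear part, both of which are bounded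
  in \<open>L\<^sup>p\<close>. Such times are dense and the nonlinear part is continuous in \<open>L\<^sup>1\<close>, so Fatou's lemma extends the
  bound to every time.
\<close>

lemma nonlinear_part_Lp_bound:
  assumes \<tau>: "0 < \<tau>" "ereal \<tau> < T"
  shows "\<exists>C\<ge>0. \<forall>t. 0 \<le> t \<and> t < \<tau> \<longrightarrow> (\<integral>\<^sup>+x. ennreal (\<bar>nonlinear_part \<tau> t x\<bar> powr p) \<partial>lborel) \<le> ennreal C"
proof -
  note meas [measurable] = nonlinear_part_L1(1)[OF \<tau>]
  obtain B where B: "0 \<le> B" and uB: "AE t in lborel. 0 < t \<and> t < \<tau> \<longrightarrow>
     in_Lm p (\<lambda>x. u x t) \<and> (\<integral>\<^sup>+x. ennreal (\<bar>u x t\<bar> powr p) \<partial>lborel) \<le> ennreal B"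
    using u_Lp_bound[OF \<tau>] .
  obtain A where A: "0 \<le> A" "\<And>t. (\<integral>\<^sup>+x. ennreal (\<bar>linear_part t x\<bar> powr p) \<partial>lborel) \<le> ennreal A"
    using linear_part_bound[OF u0_Lp] p by (metis less_imp_le)
  obtain C1 where C1: "\<And>t. (\<integral>\<^sup>+x. ennreal \<bar>nonlinear_part \<tau> t x\<bar> \<partial>lborel) \<le> ennreal C1"
    using nonlinear_part_L1(2)[OF \<tau>] by blast
  define C where "C = 2 powr p * (B + A)"
  have C: "0 \<le> C" using A B by (simp add: C_def)
  have good: "AE t in lborel. 0 < t \<and> t < \<tau> \<longrightarrow>
      (\<integral>\<^sup>+x. ennreal (\<bar>nonlinear_part \<tau> t x\<bar> powr p) \<partial>lborel) \<le> ennreal C"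
    using uB AE_solution_formula[OF \<tau>]
  proof eventually_elim
    case (elim t)
    show ?case
    proof (intro impI)
      assume t: "0 < t \<and> t < \<tau>"
      then have [measurable]: "(\<lambda>x. u x t) \<in> borel_measurable borel" using elim by (simp add: in_Lm_iff)
      have "AE x in lborel. u x t = linear_part t x + nonlinear_part \<tau> t x" using elim t by simp
      then have "AE x in lborel. ennreal (\<bar>nonlinear_part \<tau> t x\<bar> powr p) = ennreal (\<bar>u x t + (- linear_part t x)\<bar> powr p)"
        by eventually_elim simp
      then have "(\<integral>\<^sup>+x. ennreal (\<bar>nonlinear_part \<tau> t x\<bar> powr p) \<partial>lborel)
        = (\<integral>\<^sup>+x. ennreal (\<bar>u x t + (- linear_part t x)\<bar> powr p) \<partial>lborel)"
        by (rule nn_integral_cong_AE)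
      also have "\<dots> \<le> ennreal (2 powr p) * ((\<integral>\<^sup>+x. ennreal (\<bar>u x t\<bar> powr p) \<partial>lborel)
            + (\<integral>\<^sup>+x. ennreal (\<bar>- linear_part t x\<bar> powr p) \<partial>lborel))"
        using p by (intro nn_integral_powr_add_le) auto
      also have "\<dots> \<le> ennreal (2 powr p) * (ennreal B + ennreal A)"
        using elim t A by (intro mult_left_mono add_mono) auto
      also have "\<dots> = ennreal C" using A B by (simp add: C_def ennreal_mult ennreal_plus)
      finally show "(\<integral>\<^sup>+x. ennreal (\<bar>nonlinear_part \<tau> t x\<bar> powr p) \<partial>lborel) \<le> ennreal C" .
    qed
  qed
  have "(\<integral>\<^sup>+x. ennreal (\<bar>nonlinear_part \<tau> t x\<bar> powr p) \<partial>lborel) \<le> ennreal C" if t: "0 \<le> t" "t < \<tau>" for t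
  proof -
    (* A sequence of good times approaching t from the right; this also reaches t = 0. *)
    have "\<exists>s. t < s \<and> s < min \<tau> (t + 1 / real (Suc n)) \<and> (0 < s \<and> s < \<tau> \<longrightarrow>
      (\<integral>\<^sup>+x. ennreal (\<bar>nonlinear_part \<tau> s x\<bar> powr p) \<partial>lborel) \<le> ennreal C)" for n
      using t by (intro AE_lborel_exists_between[OF good]) auto
    then obtain s where s: "\<And>n. t < s n" "\<And>n. s n < min \<tau> (t + 1 / real (Suc n))"
      "\<And>n. 0 < s n \<and> s n < \<tau> \<longrightarrow> (\<integral>\<^sup>+x. ennreal (\<bar>nonlinear_part \<tau> (s n) x\<bar> powr p) \<partial>lborel) \<le> ennreal C"
      by metis
    have sb: "(\<integral>\<^sup>+x. ennreal (\<bar>nonlinear_part \<tau> (s n) x\<bar> powr p) \<partial>lborel) \<le> ennreal C" for n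
      using s(1)[of n] s(2)[of n] s(3)[of n] t by simp
    have "(\<lambda>n. t + inverse (real (Suc n))) \<longlonglongrightarrow> t + 0"
      by (intro tendsto_intros LIMSEQ_inverse_real_of_nat)
    then have up: "(\<lambda>n. t + 1 / real (Suc n)) \<longlonglongrightarrow> t" by (simp add: inverse_eq_divide)
    have lim: "s \<longlonglongrightarrow> t"
    proof (rule tendsto_sandwich[OF _ _ tendsto_const up])
      show "\<forall>\<^sub>F n in sequentially. t \<le> s n" using s(1) by (intro always_eventually allI less_imp_le)
      show "\<forall>\<^sub>F n in sequentially. s n \<le> t + 1 / real (Suc n)"
        using s(2) by (intro always_eventually allI) (meson less_imp_le min_less_iff_conj)
    qed
    show ?thesis
    proof (rule powr_integral_le_of_L1_limit[OF _ _ nonlinear_part_L1(3)[OF \<tau> lim] _ sb])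
      fix n
      have "(\<integral>\<^sup>+x. ennreal \<bar>nonlinear_part \<tau> (s n) x - nonlinear_part \<tau> t x\<bar> \<partial>lborel)
        \<le> (\<integral>\<^sup>+x. ennreal \<bar>nonlinear_part \<tau> (s n) x\<bar> + ennreal \<bar>nonlinear_part \<tau> t x\<bar> \<partial>lborel)"
        by (intro nn_integral_mono) (simp add: ennreal_plus[symmetric] ennreal_leI del: ennreal_plus)
      also have "\<dots> = (\<integral>\<^sup>+x. ennreal \<bar>nonlinear_part \<tau> (s n) x\<bar> \<partial>lborel) + (\<integral>\<^sup>+x. ennreal \<bar>nonlinear_part \<tau> t x\<bar> \<partial>lborel)"
        by (rule nn_integral_add) measurable
      also have "\<dots> \<le> ennreal C1 + ennreal C1" by (intro add_mono C1)
      also have "\<dots> < \<infinity>" by simp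
      finally show "(\<integral>\<^sup>+x. ennreal \<bar>nonlinear_part \<tau> (s n) x - nonlinear_part \<tau> t x\<bar> \<partial>lborel) < \<infinity>" .
    qed (use p in simp_all)
  qed
  then show ?thesis using C by blast
qed

text \<open>
  Interpolation between convergence in \<open>L\<^sup>1\<close> and boundedness in \<open>L\<^sup>p\<close>; it gives every exponent strictly below \<open>p\<close>.
\<close>

lemma nonlinear_part_tendsto:
  assumes \<tau>: "0 < \<tau>" "ereal \<tau> < T" and q: "1 \<le> q" "q < p"
    and s: "s \<longlonglongrightarrow> t" "\<And>n. 0 \<le> s n" and t: "0 \<le> t" "t < \<tau>"
  shows "(\<lambda>n. \<integral>\<^sup>+x. ennreal (\<bar>nonlinear_part \<tau> (s n) x - nonlinear_part \<tau> t x\<bar> powr q) \<partial>lborel) \<longlonglongrightarrow> 0"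
proof -
  note [measurable] = nonlinear_part_L1(1)[OF \<tau>]
  obtain C where C: "0 \<le> C"
    and bd: "\<And>t. 0 \<le> t \<Longrightarrow> t < \<tau> \<Longrightarrow> (\<integral>\<^sup>+x. ennreal (\<bar>nonlinear_part \<tau> t x\<bar> powr p) \<partial>lborel) \<le> ennreal C"
    using nonlinear_part_Lp_bound[OF \<tau>] by blast
  have "\<forall>\<^sub>F n in sequentially. s n < \<tau>" using s(1) t(2) by (rule order_tendstoD)
  then have "\<forall>\<^sub>F n in sequentially. (\<integral>\<^sup>+x. ennreal (\<bar>nonlinear_part \<tau> (s n) x - nonlinear_part \<tau> t x\<bar> powr p) \<partial>lborel)
      \<le> ennreal (2 powr p * (C + C))"
  proof eventually_elim
    case (elim n)
    have "(\<integral>\<^sup>+x. ennreal (\<bar>nonlinear_part \<tau> (s n) x + (- nonlinear_part \<tau> t x)\<bar> powr p) \<partial>lborel)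
      \<le> ennreal (2 powr p) * ((\<integral>\<^sup>+x. ennreal (\<bar>nonlinear_part \<tau> (s n) x\<bar> powr p) \<partial>lborel)
          + (\<integral>\<^sup>+x. ennreal (\<bar>- nonlinear_part \<tau> t x\<bar> powr p) \<partial>lborel))"
      using p by (intro nn_integral_powr_add_le) auto
    also have "\<dots> \<le> ennreal (2 powr p) * (ennreal C + ennreal C)"
      using elim s(2)[of n] t bd by (intro mult_left_mono add_mono) auto
    also have "\<dots> = ennreal (2 powr p * (C + C))" 
      using C by (simp only: ennreal_mult ennreal_plus powr_ge_zero add_nonneg_nonneg)
    finally show ?case by simp
  qed
  then show ?thesis
    using C by (intro interpolation_tendsto_0[OF _ q nonlinear_part_L1(3)[OF \<tau> s(1)], where C="2 powr p * (C + C)"]) simp_all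
qed

lemma nonlinear_part_Lq_bound:
  assumes \<tau>: "0 < \<tau>" "ereal \<tau> < T" and q: "1 \<le> q" "q < p"
  shows "\<exists>C\<ge>0. \<forall>t. 0 \<le> t \<and> t < \<tau> \<longrightarrow> (\<integral>\<^sup>+x. ennreal (\<bar>nonlinear_part \<tau> t x\<bar> powr q) \<partial>lborel) \<le> ennreal C"
proof -
  note [measurable] = nonlinear_part_L1(1)[OF \<tau>]
  obtain C where C: "0 \<le> C"
    and bd: "\<And>t. 0 \<le> t \<Longrightarrow> t < \<tau> \<Longrightarrow> (\<integral>\<^sup>+x. ennreal (\<bar>nonlinear_part \<tau> t x\<bar> powr p) \<partial>lborel) \<le> ennreal C"
    using nonlinear_part_Lp_bound[OF \<tau>] by blast
  obtain C1 where C1: "0 \<le> C1" "\<And>t. (\<integral>\<^sup>+x. ennreal \<bar>nonlinear_part \<tau> t x\<bar> \<partial>lborel) \<le> ennreal C1"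
    using nonlinear_part_L1(2)[OF \<tau>] by blast
  have "(\<integral>\<^sup>+x. ennreal (\<bar>nonlinear_part \<tau> t x\<bar> powr q) \<partial>lborel) \<le> ennreal (C1 + C)" if t: "0 \<le> t" "t < \<tau>" for t
  proof -
    have "(\<integral>\<^sup>+x. ennreal (\<bar>nonlinear_part \<tau> t x\<bar> powr q) \<partial>lborel)
      \<le> (\<integral>\<^sup>+x. ennreal \<bar>nonlinear_part \<tau> t x\<bar> \<partial>lborel) + (\<integral>\<^sup>+x. ennreal (\<bar>nonlinear_part \<tau> t x\<bar> powr p) \<partial>lborel)"
      using nn_integral_powr_interpolation_le[of "nonlinear_part \<tau> t" lborel q p 1] q by simp
    also have "\<dots> \<le> ennreal C1 + ennreal C" using C1 bd t by (intro add_mono) auto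
    finally show ?thesis using C C1 by (simp add: ennreal_plus)
  qed
  then show ?thesis using C C1 by (intro exI[of _ "C1 + C"]) auto
qed

lemma representative_Lq_bound:
  assumes u0: "in_Lm q u0" and \<tau>: "0 < \<tau>" "ereal \<tau> < T" and q: "1 \<le> q" "q < p"
  shows "\<exists>C\<ge>0. \<forall>t. 0 \<le> t \<and> t < \<tau> \<longrightarrow> in_Lm q (\<lambda>x. duhamel_representative Z Y p u0 u x t) \<and>
     (\<integral>\<^sup>+x. ennreal (\<bar>duhamel_representative Z Y p u0 u x t\<bar> powr q) \<partial>lborel) \<le> ennreal C"
proof -
  note [measurable] = nonlinear_part_L1(1)[OF \<tau>]
  obtain C where C: "0 \<le> C"
    and bd: "\<And>t. 0 \<le> t \<Longrightarrow> t < \<tau> \<Longrightarrow> (\<integral>\<^sup>+x. ennreal (\<bar>nonlinear_part \<tau> t x\<bar> powr q) \<partial>lborel) \<le> ennreal C"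
    using nonlinear_part_Lq_bound[OF \<tau> q] by blast
  obtain A where A: "0 \<le> A" "\<And>t. (\<integral>\<^sup>+x. ennreal (\<bar>linear_part t x\<bar> powr q) \<partial>lborel) \<le> ennreal A"
    using linear_part_bound[OF u0 q(1)] by metis
  have "in_Lm q (\<lambda>x. duhamel_representative Z Y p u0 u x t) \<and>
     (\<integral>\<^sup>+x. ennreal (\<bar>duhamel_representative Z Y p u0 u x t\<bar> powr q) \<partial>lborel) \<le> ennreal (2 powr q * (A + C))"
    if t: "0 \<le> t" "t < \<tau>" for t
  proof -
    have "(\<integral>\<^sup>+x. ennreal (\<bar>linear_part t x + nonlinear_part \<tau> t x\<bar> powr q) \<partial>lborel)
      \<le> ennreal (2 powr q) * ((\<integral>\<^sup>+x. ennreal (\<bar>linear_part t x\<bar> powr q) \<partial>lborel)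
          + (\<integral>\<^sup>+x. ennreal (\<bar>nonlinear_part \<tau> t x\<bar> powr q) \<partial>lborel))"
      using q by (intro nn_integral_powr_add_le) auto
    also have "\<dots> \<le> ennreal (2 powr q) * (ennreal A + ennreal C)"
      using A bd t by (intro mult_left_mono add_mono) auto
    also have "\<dots> = ennreal (2 powr q * (A + C))" using A C by (simp add: ennreal_mult ennreal_plus)
    finally have le: "(\<integral>\<^sup>+x. ennreal (\<bar>linear_part t x + nonlinear_part \<tau> t x\<bar> powr q) \<partial>lborel) \<le> ennreal (2 powr q * (A + C))" .
    have "in_Lm q (\<lambda>x. linear_part t x + nonlinear_part \<tau> t x)"
      unfolding in_Lm_iff using order.strict_trans1[OF le] by auto
    then show ?thesis
      using le by (simp add: representative_eq[OF \<tau>(2) t])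
  qed
  then show ?thesis using A C by (intro exI[of _ "2 powr q * (A + C)"]) auto
qed

text \<open>
  Continuity at \<open>t0\<close> is tested along sequences, with a horizon \<open>\<tau>\<close> between \<open>t0\<close> and \<open>T\<close>: all but finitely
  many terms lie below \<open>\<tau>\<close>, where the splitting into the two parts is valid.
\<close>

lemma representative_continuous:
  assumes u0: "in_Lm q u0" and q: "1 \<le> q" "q < p"
  shows "continuous_Lm q T (duhamel_representative Z Y p u0 u)" (is "continuous_Lm q T ?v")
proof -
  have near: "\<exists>\<tau>. t < \<tau> \<and> 0 < \<tau> \<and> ereal \<tau> < T" if "0 \<le> t" "ereal t < T" for t
    using ereal_dense2[OF that(2)] that(1) by auto
  have inq: "in_Lm q (\<lambda>x. ?v x t)" if t: "0 \<le> t" "ereal t < T" for t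
    using near[OF t] representative_Lq_bound[OF u0 _ _ q] t(1) by blast
  have "((\<lambda>t. Lm_norm q (\<lambda>x. ?v x t - ?v x t0)) \<longlongrightarrow> 0) (at t0 within {t. 0 \<le> t \<and> ereal t < T})"
    if t0: "0 \<le> t0" "ereal t0 < T" for t0
    unfolding tendsto_at_iff_sequentially
  proof (intro allI impI)
    fix s :: "nat \<Rightarrow> real"
    assume sS: "\<forall>i. s i \<in> {t. 0 \<le> t \<and> ereal t < T} - {t0}" and lim: "s \<longlonglongrightarrow> t0"
    have s: "0 \<le> s n" "ereal (s n) < T" for n using sS by auto
    obtain \<tau> where \<tau>: "t0 < \<tau>" "0 < \<tau>" "ereal \<tau> < T" using near[OF t0] by blast
    note [measurable] = nonlinear_part_L1(1)[OF \<tau>(2,3)]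
    have ev: "\<forall>\<^sub>F n in sequentially. s n < \<tau>" using lim \<tau>(1) by (rule order_tendstoD)
    define a where "a n = (\<integral>\<^sup>+x. ennreal (\<bar>linear_part (s n) x - linear_part t0 x\<bar> powr q) \<partial>lborel)" for n
    define b where "b n = (\<integral>\<^sup>+x. ennreal (\<bar>nonlinear_part \<tau> (s n) x - nonlinear_part \<tau> t0 x\<bar> powr q) \<partial>lborel)" for n
    have "a \<longlonglongrightarrow> 0" unfolding a_def by (rule linear_part_tendsto[OF u0 q(1) lim])
    moreover have "b \<longlonglongrightarrow> 0"
      unfolding b_def by (rule nonlinear_part_tendsto[OF \<tau>(2,3) q lim s(1) t0(1) \<tau>(1)])
    ultimately have "(\<lambda>n. a n + b n) \<longlonglongrightarrow> 0 + 0" by (rule tendsto_add)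
    then have "(\<lambda>n. ennreal (2 powr q) * (a n + b n)) \<longlonglongrightarrow> ennreal (2 powr q) * 0"
      by (intro ennreal_tendsto_cmult) simp_all
    then have ab: "(\<lambda>n. ennreal (2 powr q) * (a n + b n)) \<longlonglongrightarrow> 0" by simp
    have "(\<lambda>n. \<integral>\<^sup>+x. ennreal (\<bar>?v x (s n) - ?v x t0\<bar> powr q) \<partial>lborel) \<longlonglongrightarrow> 0"
    proof (rule tendsto_sandwich[OF _ _ tendsto_const ab])
      show "\<forall>\<^sub>F n in sequentially. (\<integral>\<^sup>+x. ennreal (\<bar>?v x (s n) - ?v x t0\<bar> powr q) \<partial>lborel) \<le> ennreal (2 powr q) * (a n + b n)"
        using ev
      proof eventually_elim
        case (elim n)
        have "?v x (s n) - ?v x t0 = (linear_part (s n) x - linear_part t0 x)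
             + (nonlinear_part \<tau> (s n) x - nonlinear_part \<tau> t0 x)" for x
          using representative_eq[OF \<tau>(3) s(1)[of n] elim] representative_eq[OF \<tau>(3) t0(1) \<tau>(1)] by simp
        then have "(\<integral>\<^sup>+x. ennreal (\<bar>?v x (s n) - ?v x t0\<bar> powr q) \<partial>lborel)
          = (\<integral>\<^sup>+x. ennreal (\<bar>(linear_part (s n) x - linear_part t0 x)
             + (nonlinear_part \<tau> (s n) x - nonlinear_part \<tau> t0 x)\<bar> powr q) \<partial>lborel)" by simp
        also have "\<dots> \<le> ennreal (2 powr q) * (a n + b n)"
          unfolding a_def b_def using q by (intro nn_integral_powr_add_le) auto
        finally show ?case .
      qed
    qed simp
    moreover have "(\<lambda>x. ?v x (s n) - ?v x t0) \<in> borel_measurable borel" for n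
      using in_Lm_diff[OF inq[OF s] inq[OF t0], of n] q by (simp add: in_Lm_iff)
    ultimately have "(\<lambda>n. Lm_norm q (\<lambda>x. ?v x (s n) - ?v x t0)) \<longlonglongrightarrow> 0"
      using q by (intro powr_dist_tendsto_imp_Lm_norm_tendsto) auto
    then show "((\<lambda>t. Lm_norm q (\<lambda>x. ?v x t - ?v x t0)) \<circ> s) \<longlonglongrightarrow> 0" by (simp add: o_def)
  qed
  then show ?thesis unfolding continuous_Lm_def using inq by blast
qed

text \<open>
  The continuous representative agrees with \<open>u\<close> at almost every time, so its local bounds and its continuity at
  time 0 give the local bounds and the initial condition for \<open>u\<close>.
\<close>

lemma Lq_solution:
  assumes u0: "in_Lm q u0" and q: "1 \<le> q" "q < p"
  shows "Lm_solution Z Y p q u0 T u"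
proof -
  let ?v = "duhamel_representative Z Y p u0 u"
  note cont = representative_continuous[OF assms]
  have T: "0 < T" using sol by (simp add: Lm_solution_def)
  have base: "AE t in lborel. 0 < t \<and> ereal t < T \<longrightarrow>
        duhamel_converges Z Y p u0 u t \<and> in_Lm p (\<lambda>x. u x t) \<and> in_Lm p (duhamel_rhs Z Y p u0 u t) \<and>
        (AE x in lborel. u x t = duhamel_rhs Z Y p u0 u t x)"
    using sol by (simp add: Lm_solution_def)
  have slice: "AE t in lborel. 0 < t \<and> ereal t < T \<longrightarrow>
        duhamel_converges Z Y p u0 u t \<and> in_Lm q (\<lambda>x. u x t) \<and> in_Lm q (duhamel_rhs Z Y p u0 u t) \<and>
        (AE x in lborel. u x t = duhamel_rhs Z Y p u0 u t x)"
    using base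
  proof eventually_elim
    case (elim t)
    show ?case
    proof (intro impI)
      assume t: "0 < t \<and> ereal t < T"
      have rhs: "(\<lambda>x. ?v x t) = duhamel_rhs Z Y p u0 u t"
        using t by (auto simp: duhamel_representative_def)
      have "in_Lm q (duhamel_rhs Z Y p u0 u t)"
        using cont t unfolding continuous_Lm_def rhs[symmetric] by (simp add: less_imp_le)
      moreover from this have "in_Lm q (\<lambda>x. u x t)"
        using elim t by (intro in_Lm_cong_AE[of "\<lambda>x. u x t" "duhamel_rhs Z Y p u0 u t"]) (auto simp: in_Lm_iff)
      ultimately show "duhamel_converges Z Y p u0 u t \<and> in_Lm q (\<lambda>x. u x t) \<and> in_Lm q (duhamel_rhs Z Y p u0 u t) \<and>
        (AE x in lborel. u x t = duhamel_rhs Z Y p u0 u t x)" using elim t by simp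
    qed
  qed
  have bound: "\<exists>M. AE t in lborel. 0 < t \<and> t < \<tau> \<longrightarrow> in_Lm q (\<lambda>x. u x t) \<and> Lm_norm q (\<lambda>x. u x t) \<le> M"
    if \<tau>: "0 < \<tau>" "ereal \<tau> < T" for \<tau>
  proof -
    obtain C where C: "0 \<le> C" and vC: "\<And>t. 0 \<le> t \<Longrightarrow> t < \<tau> \<Longrightarrow> in_Lm q (\<lambda>x. ?v x t) \<and>
       (\<integral>\<^sup>+x. ennreal (\<bar>?v x t\<bar> powr q) \<partial>lborel) \<le> ennreal C"
      using representative_Lq_bound[OF u0 \<tau> q] by blast
    have "AE t in lborel. 0 < t \<and> t < \<tau> \<longrightarrow> in_Lm q (\<lambda>x. u x t) \<and> Lm_norm q (\<lambda>x. u x t) \<le> C powr (1 / q)"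
      using slice
    proof eventually_elim
      case (elim t)
      show ?case
      proof (intro impI)
        assume t: "0 < t \<and> t < \<tau>"
        then have "ereal t < T" using \<tau> by (meson ereal_less_eq(3) less_imp_le order.strict_trans1)
        with elim t have e: "in_Lm q (\<lambda>x. u x t)" "in_Lm q (duhamel_rhs Z Y p u0 u t)"
          "AE x in lborel. u x t = duhamel_rhs Z Y p u0 u t x" by auto
        have rhs: "(\<lambda>x. ?v x t) = duhamel_rhs Z Y p u0 u t"
          using t by (auto simp: duhamel_representative_def)
        have "Lm_norm q (\<lambda>x. u x t) = Lm_norm q (duhamel_rhs Z Y p u0 u t)"
          using e by (intro Lm_norm_cong_AE) (auto simp: in_Lm_iff)
        also have "\<dots> \<le> C powr (1 / q)"
          unfolding rhs[symmetric] using vC[of t] t q C by (intro Lm_norm_le_of_powr_integral_le) auto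
        finally show "in_Lm q (\<lambda>x. u x t) \<and> Lm_norm q (\<lambda>x. u x t) \<le> C powr (1 / q)" using e by simp
      qed
    qed
    then show ?thesis by blast
  qed
  have initial: "\<exists>\<delta>>0. AE t in lborel. 0 < t \<and> t < \<delta> \<and> ereal t < T \<longrightarrow>
        in_Lm q (\<lambda>x. u x t - u0 x) \<and> Lm_norm q (\<lambda>x. u x t - u0 x) < \<epsilon>" if \<epsilon>: "0 < \<epsilon>" for \<epsilon>
  proof -
    have "((\<lambda>t. Lm_norm q (\<lambda>x. ?v x t - ?v x 0)) \<longlongrightarrow> 0) (at 0 within {t. 0 \<le> t \<and> ereal t < T})"
      using cont T unfolding continuous_Lm_def by (simp add: zero_ereal_def)
    then have "\<forall>\<^sub>F t in at 0 within {t. 0 \<le> t \<and> ereal t < T}. Lm_norm q (\<lambda>x. ?v x t - ?v x 0) < \<epsilon>"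
      using \<epsilon> by (rule order_tendstoD)
    then obtain \<delta> where \<delta>: "0 < \<delta>"
      and small: "\<And>t. 0 \<le> t \<Longrightarrow> ereal t < T \<Longrightarrow> t \<noteq> 0 \<Longrightarrow> dist t 0 < \<delta> \<Longrightarrow> Lm_norm q (\<lambda>x. ?v x t - ?v x 0) < \<epsilon>"
      unfolding eventually_at by blast
    have "AE t in lborel. 0 < t \<and> t < \<delta> \<and> ereal t < T \<longrightarrow>
        in_Lm q (\<lambda>x. u x t - u0 x) \<and> Lm_norm q (\<lambda>x. u x t - u0 x) < \<epsilon>"
      using slice
    proof eventually_elim
      case (elim t)
      show ?case
      proof (intro impI)
        assume t: "0 < t \<and> t < \<delta> \<and> ereal t < T"
        with elim have e: "in_Lm q (\<lambda>x. u x t)" "in_Lm q (duhamel_rhs Z Y p u0 u t)"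
          "AE x in lborel. u x t = duhamel_rhs Z Y p u0 u t x" by auto
        have 1: "in_Lm q (\<lambda>x. u x t - u0 x)" "in_Lm q (\<lambda>x. duhamel_rhs Z Y p u0 u t x - u0 x)"
          using e u0 q by (auto intro: in_Lm_diff)
        have "AE x in lborel. u x t - u0 x = duhamel_rhs Z Y p u0 u t x - u0 x"
          using e(3) by eventually_elim simp
        then have "Lm_norm q (\<lambda>x. u x t - u0 x) = Lm_norm q (\<lambda>x. duhamel_rhs Z Y p u0 u t x - u0 x)"
          using 1 by (intro Lm_norm_cong_AE) (auto simp: in_Lm_iff)
        also have "\<dots> = Lm_norm q (\<lambda>x. ?v x t - ?v x 0)"
          using t by (simp add: duhamel_representative_def)
        also have "\<dots> < \<epsilon>" using small[of t] t by (simp add: dist_real_def)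
        finally show "in_Lm q (\<lambda>x. u x t - u0 x) \<and> Lm_norm q (\<lambda>x. u x t - u0 x) < \<epsilon>" using 1 by simp
      qed
    qed
    then show ?thesis using \<delta> by blast
  qed
  have "Linf_loc_Lm q T u"
    using sol bound unfolding Lm_solution_def Linf_loc_Lm_def by blast
  then show ?thesis
    unfolding Lm_solution_def using u0 q T slice initial by blast
qed

end

section \<open>Solutions in the smaller Lebesgue space\<close>

theorem theorem4p1:
  fixes \<alpha> \<beta> p q p\<^sub>c :: real
    and Z Y u :: "'a::euclidean_space \<Rightarrow> real \<Rightarrow> real"
    and u0 :: "'a \<Rightarrow> real"
    and T :: ereal
  assumes "0 < \<alpha>" and "\<alpha> < 1"
    and "0 < \<beta>" and "\<beta> \<le> 1"
    and "real DIM('a) > 4 * \<beta>"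
    and "is_kernel_Z \<alpha> \<beta> Z"
    and "is_kernel_Y \<alpha> \<beta> Y"
    and "p\<^sub>c = real DIM('a) / (real DIM('a) - 2 * \<beta>)"
    and "1 \<le> p" and "p < p\<^sub>c"
    and "1 \<le> q" and "q < p"
    and "0 < T"
    and "in_Lm p u0" and "in_Lm q u0"
    and "Lm_solution Z Y p p u0 T u"
  shows "Lm_solution Z Y p q u0 T u \<and>
         (\<forall>t. 0 < t \<and> ereal t < T \<longrightarrow> duhamel_converges Z Y p u0 u t) \<and>
         continuous_Lm q T (duhamel_representative Z Y p u0 u)"
proof -
  interpret fractional_solution \<alpha> \<beta> p Z Y u u0 T
    using assms by unfold_locales auto
  show ?thesis
    using Lq_solution[of q] representative_continuous[of q] duhamel_converges_all assms by blast
qed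

end
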